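(* Let $K \subset \mathbb{R}^2$ be a compact, simply connected set and let $P_1, P_2, P_3$ be finite subsets of $K$. Suppose that for every choice $p_1 \in P_1$, $p_2 \in P_2$, $p_3 \in P_3$ there exists a point $x \in K$ that sees $p_1$, $p_2$ and $p_3$. Then there exist an index $i \in \{1,2,3\}$ and a point $x \in K$ that sees every point of $P_i$.
   Context: For $K \subset \mathbb{R}^d$ and $x,y \in K$, we say $x$ sees $y$ (in $K$) if the closed segment $[x,y]$ is contained in $K$. *)

theory Defs
  imports "HOL-Analysis.Analysis"
begin

text \<open>The library predicate \<^const>\<open>simply_connected\<close> (which implies path-connectedness) also holds of
  the empty set; a simply connected set is meant to be nonempty here, so statements assume
  nonemptiness separately.\<close>

definition sees :: "'a::real_vector set \<Rightarrow> 'a \<Rightarrow> 'a \<Rightarrow> bool" where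
  "sees K x y \<longleftrightarrow> x \<in> K \<and> y \<in> K \<and> closed_segment x y \<subseteq> K"

end

theory Submission imports Defs
begin

text \<open>
  Replace \<open>K\<close> by the union \<open>G\<close> of the finitely many segments joining the given points to the witnesses.
  \<open>G\<close> is locally path-connected, so lifting through the exponential shows that every bounded component of
  \<open>- G\<close> lies in \<open>K\<close>; this can fail for \<open>K\<close> itself, since the Warsaw circle is simply connected. Hence
  it suffices to treat \<open>G\<close> with its holes filled, which is a decreasing intersection of filled dyadic
  grid neighbourhoods \<open>X\<close>, and compactness passes the conclusion to the limit.

  For such an \<open>X\<close> any two visibility sets have connected intersection, and every visibility set meets each
  convex part of \<open>X\<close> in a convex set. Unicoherence of \<open>X\<close> makes the maximal horizontal rectangles of \<open>X\<close>
  into a tree: each rectangle meets the union of its predecessors in a segment, its gate. Order the points of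
  \<open>X\<close> by rectangle first, then by distance to the gate. Every intersection of two visibility sets then has a
  least element, and by Helly's theorem inside one rectangle the least element of a triple intersection is
  already the least element of a pair. As in Lovasz' proof of the colourful Helly theorem, a maximal element
  among the least elements of the two-coloured pairs lies in all visibility sets of the third colour.
\<close>

section \<open>Least elements and the colourful Helly argument\<close>

text \<open>The order \<open>tree_less\<close> below can leave pairs incomparable, so a least
  element is required to be strictly below every other one.\<close>

definition is_least :: "('a \<Rightarrow> 'a \<Rightarrow> bool) \<Rightarrow> 'a set \<Rightarrow> 'a \<Rightarrow> bool" where
  "is_least lt S m \<longleftrightarrow> m \<in> S \<and> (\<forall>y\<in>S. y \<noteq> m \<longrightarrow> lt m y)"

lemma is_least_unique:
  assumes "asymp lt" "is_least lt S m" "is_least lt S m'"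
  shows "m = m'"
  using assms unfolding is_least_def by (metis asympD)

text \<open>Let \<open>m\<close> be maximal among the least elements of pairs of different colours,
  attained by \<open>p\<close> and \<open>q\<close>. For \<open>r\<close> of the third colour, the
  point \<open>h\<close> given by \<open>triple\<close> is itself such a least element and lies in
  \<open>A p \<inter> A q\<close>, so it is \<open>m\<close> or above \<open>m\<close>. Maximality
  leaves \<open>h = m\<close>, hence \<open>m\<close> lies in \<open>A r\<close>.\<close>

lemma colorful_of_least_elements:
  fixes A :: "'b \<Rightarrow> 'a set" and P :: "nat \<Rightarrow> 'b set"
  assumes "transp lt" and asym: "asymp lt"
    and P: "\<And>i. i \<in> {1, 2, 3} \<Longrightarrow> finite (P i) \<and> P i \<noteq> {}"
    and pair: "\<And>i j p q. \<lbrakk>i \<in> {1, 2, 3}; j \<in> {1, 2, 3}; i \<noteq> j; p \<in> P i; q \<in> P j\<rbrakk>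
               \<Longrightarrow> \<exists>m. is_least lt (A p \<inter> A q) m"
    and triple: "\<And>i j k p q r. \<lbrakk>{i, j, k} = {1, 2, 3}; p \<in> P i; q \<in> P j; r \<in> P k\<rbrakk>
               \<Longrightarrow> \<exists>h \<in> A p \<inter> A q \<inter> A r. is_least lt (A p \<inter> A q) h \<or> is_least lt (A p \<inter> A r) h
                     \<or> is_least lt (A q \<inter> A r) h"
  shows "\<exists>i\<in>{1, 2, 3}. \<exists>x. \<forall>p\<in>P i. x \<in> A p"
proof -
  define rainbow where "rainbow i j p q \<longleftrightarrow> i \<in> {1, 2, 3} \<and> j \<in> {1, 2, 3} \<and> i \<noteq> j \<and> p \<in> P i \<and> q \<in> P j"
    for i j :: nat and p q
  define M where "M = {m. \<exists>i j p q. rainbow i j p q \<and> is_least lt (A p \<inter> A q) m}"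
  \<comment> \<open>Least elements are unique, so each pair of indices contributes at most one and
    \<open>M\<close> is finite.\<close>
  have "M \<subseteq> (\<lambda>(p, q). THE m. is_least lt (A p \<inter> A q) m) ` ((P 1 \<union> P 2 \<union> P 3) \<times> (P 1 \<union> P 2 \<union> P 3))"
  proof
    fix m assume "m \<in> M"
    then obtain i j p q where r: "rainbow i j p q" and m: "is_least lt (A p \<inter> A q) m"
      unfolding M_def by blast
    have "(THE m. is_least lt (A p \<inter> A q) m) = m"
      using m is_least_unique[OF asym] by blast
    moreover have "(p, q) \<in> (P 1 \<union> P 2 \<union> P 3) \<times> (P 1 \<union> P 2 \<union> P 3)"
      using r unfolding rainbow_def by auto
    ultimately show "m \<in> (\<lambda>(p, q). THE m. is_least lt (A p \<inter> A q) m) ` ((P 1 \<union> P 2 \<union> P 3) \<times> (P 1 \<union> P 2 \<union> P 3))"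
      by force
  qed
  then have finM: "finite M"
    using P by (auto intro: finite_subset)
  obtain p1 p2 where "p1 \<in> P 1" "p2 \<in> P 2"
    using P by fastforce
  then have "rainbow 1 2 p1 p2" "\<exists>m. is_least lt (A p1 \<inter> A p2) m"
    using pair[of 1 2 p1 p2] by (auto simp: rainbow_def)
  then have "M \<noteq> {}"
    unfolding M_def by blast
  moreover have "asymp_on M lt" "transp_on M lt"
    using assms(1,2) asymp_on_subset transp_on_subset by blast+
  ultimately obtain m where "m \<in> M" and max: "\<And>x. x \<in> M \<Longrightarrow> x \<noteq> m \<Longrightarrow> \<not> lt m x"
    using Finite_Set.bex_max_element[OF finM] by metis
  then obtain i j p q where r: "rainbow i j p q" and m: "is_least lt (A p \<inter> A q) m"
    unfolding M_def by blast
  \<comment> \<open>The three colours sum to 6, so this is the remaining one.\<close>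
  define k where "k = 6 - i - j"
  have ijk: "{i, j, k} = {1, 2, 3}" "k \<in> {1, 2, 3}" "i \<noteq> k" "j \<noteq> k"
    using r unfolding rainbow_def k_def by auto
  have "m \<in> A r" if rk: "r \<in> P k" for r
  proof -
    obtain h where h: "h \<in> A p \<inter> A q \<inter> A r" "is_least lt (A p \<inter> A q) h \<or> is_least lt (A p \<inter> A r) h
                     \<or> is_least lt (A q \<inter> A r) h"
      using triple[OF ijk(1) _ _ rk, of p q] r unfolding rainbow_def by blast
    then have "h \<in> M"
      using r that ijk unfolding M_def rainbow_def by blast
    moreover have "h = m \<or> lt m h"
      using m h(1) unfolding is_least_def by blast
    ultimately show ?thesis
      using h(1) max by blast
  qed
  then show ?thesis
    using ijk by blast
qed

section \<open>Helly's theorem in the plane and convex sublevel sets\<close>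

text \<open>Helly's theorem counts the members of a set of sets, so four sets of which two coincide
  are treated apart: there one of the triple intersections is already the full intersection.\<close>

lemma Helly_four:
  fixes A B C D :: "'a::euclidean_space set"
  assumes dim: "DIM('a) = 2" and conv: "convex A" "convex B" "convex C" "convex D"
    and ne: "A \<inter> B \<inter> C \<noteq> {}" "A \<inter> B \<inter> D \<noteq> {}" "A \<inter> C \<inter> D \<noteq> {}" "B \<inter> C \<inter> D \<noteq> {}"
  shows "A \<inter> B \<inter> C \<inter> D \<noteq> {}"
proof (cases "distinct [A, B, C, D]")
  case False
  then show ?thesis
    using ne by auto
next
  case True
  have "\<Inter>{A, B, C, D} \<noteq> {}"
  proof (rule Helly)
    show "DIM('a) + 1 \<le> card {A, B, C, D}"
      using True dim by auto
    show "\<forall>S\<in>{A, B, C, D}. convex S"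
      using conv by auto
    show "\<Inter>T \<noteq> {}" if T: "T \<subseteq> {A, B, C, D}" "card T = DIM('a) + 1" for T
    proof -
      have "card ({A, B, C, D} - T) = 1"
        using T dim True by (subst card_Diff_subset) (auto intro: finite_subset)
      then obtain S where S: "{A, B, C, D} - T = {S}"
        using card_1_singletonE by blast
      then have "T = {A, B, C, D} - {S}" "S \<in> {A, B, C, D}"
        using T by auto
      moreover have "{A, B, C, D} - {A} = {B, C, D}" "{A, B, C, D} - {B} = {A, C, D}"
        "{A, B, C, D} - {C} = {A, B, D}" "{A, B, C, D} - {D} = {A, B, C}"
        using True by auto
      ultimately have "T = {B, C, D} \<or> T = {A, C, D} \<or> T = {A, B, D} \<or> T = {A, B, C}"
        by (metis empty_iff insertE)
      then show ?thesis
        using ne by (elim disjE) (simp_all add: Int_assoc)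
    qed
  qed
  then show ?thesis
    by (simp add: Int_assoc)
qed

text \<open>The combination of nearest points of \<open>x\<close> and \<open>y\<close> competes for
  the distance of the combined point. Nearest points are taken in the closure, which is at the same
  distance.\<close>

lemma infdist_convex_combination_le:
  fixes S :: "'a::euclidean_space set"
  assumes "convex S" "0 \<le> u" "0 \<le> v" "u + v = 1"
  shows "infdist (u *\<^sub>R x + v *\<^sub>R y) S \<le> u * infdist x S + v * infdist y S"
proof (cases "S = {}")
  \<comment> \<open>Gates can be empty; \<open>infdist\<close> to the empty set is 0.\<close>
  case True
  then show ?thesis by (simp add: infdist_def)
next
  case False
  let ?S = "closure S"
  have cl: "closed ?S" "?S \<noteq> {}" "convex ?S"
    using False assms by (auto simp: convex_closure)
  obtain a where a: "a \<in> ?S" "infdist x ?S = dist x a"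
    using infdist_attains_inf[OF cl(1,2)] by blast
  obtain b where b: "b \<in> ?S" "infdist y ?S = dist y b"
    using infdist_attains_inf[OF cl(1,2)] by blast
  have "u *\<^sub>R a + v *\<^sub>R b \<in> ?S"
    using convexD[OF cl(3) a(1) b(1)] assms by simp
  then have "infdist (u *\<^sub>R x + v *\<^sub>R y) ?S \<le> dist (u *\<^sub>R x + v *\<^sub>R y) (u *\<^sub>R a + v *\<^sub>R b)"
    by (rule infdist_le)
  also have "\<dots> = norm (u *\<^sub>R (x - a) + v *\<^sub>R (y - b))"
    by (simp add: dist_norm algebra_simps)
  also have "\<dots> \<le> u * dist x a + v * dist y b"
    using norm_triangle_ineq[of "u *\<^sub>R (x - a)" "v *\<^sub>R (y - b)"] assms by (simp add: dist_norm)
  finally show ?thesis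
    using a b False by (simp add: infdist_eq_setdist)
qed

text \<open>This supplies the fourth convex set for Helly's theorem. Distance and norm are both
  convex functions; if a combination attains the bound \<open>t\<close>, each end of positive weight
  has distance exactly \<open>t\<close> and therefore norm below \<open>r\<close>.\<close>

lemma convex_lex_sublevel:
  fixes S :: "'a::euclidean_space set"
  assumes "convex S" "convex E"
  shows "convex {x \<in> S. infdist x E < t \<or> infdist x E = t \<and> norm x < r}"
proof (rule convexI)
  fix x y and u v :: real
  let ?T = "{x \<in> S. infdist x E < t \<or> infdist x E = t \<and> norm x < r}"
  assume x: "x \<in> ?T" and y: "y \<in> ?T" and uv: "0 \<le> u" "0 \<le> v" "u + v = 1"
  let ?z = "u *\<^sub>R x + v *\<^sub>R y"
  have S: "?z \<in> S"
    using convexD[OF assms(1)] x y uv by blast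
  have le: "infdist ?z E \<le> u * infdist x E + v * infdist y E"
    by (rule infdist_convex_combination_le[OF assms(2) uv])
  have xt: "infdist x E \<le> t" and yt: "infdist y E \<le> t"
    using x y by auto
  have "u * infdist x E \<le> u * t" "v * infdist y E \<le> v * t"
    using xt yt uv by (auto intro: mult_left_mono)
  moreover have sum: "u * t + v * t = t"
    using uv by (metis distrib_right mult_1)
  ultimately have zt: "infdist ?z E \<le> t"
    using le by linarith
  have "norm ?z < r" if "infdist ?z E = t"
  proof -
    have *: "u * infdist x E = u * t" "v * infdist y E = v * t"
      using le that sum \<open>u * infdist x E \<le> u * t\<close> \<open>v * infdist y E \<le> v * t\<close> by linarith+
    have nx: "u * norm x < u * r \<or> u = 0" and ny: "v * norm y < v * r \<or> v = 0"
      using * x y uv by (auto simp: less_le)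
    have "norm ?z \<le> u * norm x + v * norm y"
      using norm_triangle_ineq[of "u *\<^sub>R x" "v *\<^sub>R y"] uv by simp
    also have "\<dots> < u * r + v * r"
      using nx ny uv by fastforce
    also have "\<dots> = r"
      using uv by (metis distrib_right mult_1)
    finally show ?thesis .
  qed
  then show "?z \<in> ?T"
    using S zt by auto
qed

section \<open>Trees of convex sets and the order on their points\<close>

text \<open>The last set is the gate of the piece \<open>L k\<close>. The gate of \<open>L 0\<close>
  is empty, which counts as convex.\<close>

definition tree_of_convex_sets :: "(nat \<Rightarrow> 'a::euclidean_space set) \<Rightarrow> nat \<Rightarrow> bool" where
  "tree_of_convex_sets L N \<longleftrightarrow>
     (\<forall>k<N. compact (L k) \<and> convex (L k) \<and> convex (L k \<inter> (\<Union>j<k. L j)))"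

text \<open>A point of several pieces is credited to the earliest, so the points of
  \<open>L k\<close> with index \<open>k\<close> are those off its gate.\<close>

definition piece_index :: "(nat \<Rightarrow> 'a set) \<Rightarrow> 'a \<Rightarrow> nat" where
  "piece_index L x = (LEAST k. x \<in> L k)"

text \<open>Since the distance to the gate \<open>L k \<inter> (\<Union>j<k. L j)\<close> is compared first, a set which reaches the gate has
  points below every point of \<open>L k\<close> outside the gate; the norm only serves to break ties.\<close>

definition tree_less :: "(nat \<Rightarrow> 'a::euclidean_space set) \<Rightarrow> 'a \<Rightarrow> 'a \<Rightarrow> bool" where
  "tree_less L x y \<longleftrightarrow> piece_index L x < piece_index L y \<or> piece_index L x = piece_index L y \<and>
     (let E = L (piece_index L y) \<inter> (\<Union>j<piece_index L y. L j) in
        infdist x E < infdist y E \<or> infdist x E = infdist y E \<and> norm x < norm y)"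

lemma transp_tree_less: "transp (tree_less L)"
  unfolding transp_def tree_less_def Let_def by auto

lemma asymp_tree_less: "asymp (tree_less L)"
  unfolding asymp_on_def tree_less_def Let_def by auto

lemma piece_index_le: "x \<in> L k \<Longrightarrow> piece_index L x \<le> k"
  unfolding piece_index_def by (rule Least_le)

lemma in_piece_index: "x \<in> (\<Union>k\<in>I. L k) \<Longrightarrow> x \<in> L (piece_index L x)"
  unfolding piece_index_def by (auto intro: LeastI)

lemma not_in_earlier_piece: "k < piece_index L x \<Longrightarrow> x \<notin> L k"
  using piece_index_le[of x L k] by force

text \<open>Minimise the distance first. Its minimisers form a closed convex set, in which the point
  nearest to 0 is unique; that uniqueness makes the comparison strict.\<close>

lemma ex_lex_min:
  fixes D E :: "'a::euclidean_space set"
  assumes "compact D" "convex D" "convex E" "D \<noteq> {}"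
  obtains m where "m \<in> D"
    "\<And>y. y \<in> D \<Longrightarrow> y \<noteq> m \<Longrightarrow> infdist m E < infdist y E \<or> infdist m E = infdist y E \<and> norm m < norm y"
proof -
  have cont: "continuous_on D (\<lambda>x. infdist x E)"
    by (intro continuous_intros)
  obtain a where a: "a \<in> D" "\<And>y. y \<in> D \<Longrightarrow> infdist a E \<le> infdist y E"
    using continuous_attains_inf[OF assms(1,4) cont] by blast
  define D' where "D' = {x \<in> D. infdist x E \<le> infdist a E}"
  have "convex D'"
  proof (rule convexI)
    fix x y and u v :: real
    assume xy: "x \<in> D'" "y \<in> D'" and uv: "0 \<le> u" "0 \<le> v" "u + v = 1"
    have "infdist (u *\<^sub>R x + v *\<^sub>R y) E \<le> u * infdist x E + v * infdist y E"
      by (rule infdist_convex_combination_le[OF assms(3) uv])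
    also have "\<dots> \<le> u * infdist a E + v * infdist a E"
      using xy uv unfolding D'_def by (intro add_mono mult_left_mono) auto
    also have "\<dots> = infdist a E"
      using uv by (metis distrib_right mult_1)
    finally show "u *\<^sub>R x + v *\<^sub>R y \<in> D'"
      using xy uv assms(2) unfolding D'_def by (simp add: convexD)
  qed
  moreover have "closed D'"
  proof -
    have "D' = D \<inter> (\<lambda>x. infdist x E) -` {..infdist a E}"
      unfolding D'_def by auto
    then show ?thesis
      using continuous_on_closed_vimage[of D "\<lambda>x. infdist x E"] cont assms(1)
      by (metis Int_commute closed_atMost compact_imp_closed)
  qed
  moreover have "a \<in> D'"
    using a unfolding D'_def by simp
  ultimately have m: "closest_point D' 0 \<in> D'"
      "\<And>y. y \<in> D' \<Longrightarrow> y \<noteq> closest_point D' 0 \<Longrightarrow> norm (closest_point D' 0) < norm y"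
    using closest_point_in_set[of D' 0] closest_point_lt[of D' _ 0] by auto
  show thesis
  proof (rule that)
    show "closest_point D' 0 \<in> D"
      using m(1) unfolding D'_def by simp
    fix y assume y: "y \<in> D" "y \<noteq> closest_point D' 0"
    have "infdist (closest_point D' 0) E = infdist a E"
      using m(1) a(2)[of "closest_point D' 0"] unfolding D'_def by auto
    moreover have "infdist a E < infdist y E \<or> infdist a E = infdist y E \<and> y \<in> D'"
      using a(2)[OF y(1)] y(1) unfolding D'_def by auto
    ultimately show "infdist (closest_point D' 0) E < infdist y E \<or>
        infdist (closest_point D' 0) E = infdist y E \<and> norm (closest_point D' 0) < norm y"
      using m(2)[of y] y(2) by auto
  qed
qed

text \<open>Take the first piece that \<open>C\<close> meets. Every point of \<open>C\<close> in it
  has exactly that index, and all other points of \<open>C\<close> have a larger one, so the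
  lexicographic minimum inside the piece is least.\<close>

lemma ex_least_tree_less:
  assumes L: "tree_of_convex_sets L N" and C: "\<And>k. k < N \<Longrightarrow> compact (C \<inter> L k) \<and> convex (C \<inter> L k)"
    and sub: "C \<subseteq> (\<Union>k<N. L k)" and "C \<noteq> {}"
  shows "\<exists>m. is_least (tree_less L) C m"
proof -
  define k where "k = (LEAST k. C \<inter> L k \<noteq> {})"
  obtain k0 where k0: "k0 < N" "C \<inter> L k0 \<noteq> {}"
    using sub \<open>C \<noteq> {}\<close> by fast
  have k: "C \<inter> L k \<noteq> {}" "k < N"
    using LeastI[of "\<lambda>k. C \<inter> L k \<noteq> {}", OF k0(2)] Least_le[of "\<lambda>k. C \<inter> L k \<noteq> {}", OF k0(2)] k0(1)
    unfolding k_def by auto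
  have min: "C \<inter> L j = {}" if "j < k" for j
    using not_less_Least that unfolding k_def by blast
  have ge: "k \<le> piece_index L y" if "y \<in> C" for y
  proof -
    have "y \<in> L (piece_index L y)"
      using in_piece_index[of y L "{..<N}"] sub that by blast
    then have "C \<inter> L (piece_index L y) \<noteq> {}"
      using that by blast
    then show ?thesis
      using min not_less by blast
  qed
  have eq: "piece_index L y = k" if "y \<in> C \<inter> L k" for y
    using that ge piece_index_le by (metis IntD1 IntD2 le_antisym)
  obtain m where m: "m \<in> C \<inter> L k"
    "\<And>y. y \<in> C \<inter> L k \<Longrightarrow> y \<noteq> m \<Longrightarrow> infdist m (L k \<inter> (\<Union>j<k. L j)) < infdist y (L k \<inter> (\<Union>j<k. L j))
       \<or> infdist m (L k \<inter> (\<Union>j<k. L j)) = infdist y (L k \<inter> (\<Union>j<k. L j)) \<and> norm m < norm y"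
    using ex_lex_min[of "C \<inter> L k" "L k \<inter> (\<Union>j<k. L j)"] C[OF k(2)] L k unfolding tree_of_convex_sets_def
    by metis
  have "tree_less L m y" if y: "y \<in> C" "y \<noteq> m" for y
  proof (cases "piece_index L y = k")
    case True
    then have "y \<in> L k"
      using in_piece_index[of y L "{..<N}"] sub y by auto
    then show ?thesis
      using m(2)[of y] y eq[OF m(1)] True unfolding tree_less_def by (simp add: Let_def)
  next
    case False
    then show ?thesis
      using ge[OF y(1)] eq[OF m(1)] unfolding tree_less_def by simp
  qed
  then show ?thesis
    using m(1) unfolding is_least_def by blast
qed

text \<open>Let \<open>h\<close> be least in the triple intersection, with index \<open>k\<close>.
  The points of \<open>L k\<close> preceding \<open>h\<close> form a convex set with no point common
  to \<open>A\<close>, \<open>B\<close> and \<open>C\<close>, so by Helly some pair misses this set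
  inside \<open>L k\<close>. For that pair \<open>h\<close> is least: a smaller point in an earlier
  piece would, by the gate hypothesis, yield a point of the pair on the gate, which also precedes
  \<open>h\<close>.\<close>

lemma least_of_triple_is_least_of_pair:
  fixes L :: "nat \<Rightarrow> 'a::euclidean_space set"
  assumes dim: "DIM('a) = 2" and L: "tree_of_convex_sets L N"
    and A: "\<And>k. k < N \<Longrightarrow> compact (A \<inter> L k) \<and> convex (A \<inter> L k)"
    and B: "\<And>k. k < N \<Longrightarrow> compact (B \<inter> L k) \<and> convex (B \<inter> L k)"
    and C: "\<And>k. k < N \<Longrightarrow> compact (C \<inter> L k) \<and> convex (C \<inter> L k)"
    and sub: "A \<subseteq> (\<Union>k<N. L k)" "B \<subseteq> (\<Union>k<N. L k)"
    and gateAB: "\<And>k. k < N \<Longrightarrow> A \<inter> B \<inter> L k \<noteq> {} \<Longrightarrow> A \<inter> B \<inter> (\<Union>j<k. L j) \<noteq> {} \<Longrightarrow> A \<inter> B \<inter> (L k \<inter> (\<Union>j<k. L j)) \<noteq> {}"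
    and gateAC: "\<And>k. k < N \<Longrightarrow> A \<inter> C \<inter> L k \<noteq> {} \<Longrightarrow> A \<inter> C \<inter> (\<Union>j<k. L j) \<noteq> {} \<Longrightarrow> A \<inter> C \<inter> (L k \<inter> (\<Union>j<k. L j)) \<noteq> {}"
    and gateBC: "\<And>k. k < N \<Longrightarrow> B \<inter> C \<inter> L k \<noteq> {} \<Longrightarrow> B \<inter> C \<inter> (\<Union>j<k. L j) \<noteq> {} \<Longrightarrow> B \<inter> C \<inter> (L k \<inter> (\<Union>j<k. L j)) \<noteq> {}"
    and ne: "A \<inter> B \<inter> C \<noteq> {}"
  shows "\<exists>h \<in> A \<inter> B \<inter> C. is_least (tree_less L) (A \<inter> B) h \<or> is_least (tree_less L) (A \<inter> C) h
                     \<or> is_least (tree_less L) (B \<inter> C) h"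
proof -
  have conv: "compact (S \<inter> T \<inter> L k) \<and> convex (S \<inter> T \<inter> L k)"
    if "compact (S \<inter> L k) \<and> convex (S \<inter> L k)" "compact (T \<inter> L k) \<and> convex (T \<inter> L k)" for S T k
  proof -
    have "S \<inter> T \<inter> L k = (S \<inter> L k) \<inter> (T \<inter> L k)" by blast
    then show ?thesis
      using that by (simp add: compact_Int convex_Int)
  qed
  have "\<exists>h. is_least (tree_less L) (A \<inter> B \<inter> C) h"
    using ex_least_tree_less[OF L, of "A \<inter> B \<inter> C"] A B C conv sub(1) ne by (simp add: le_infI1)
  then obtain h where h: "is_least (tree_less L) (A \<inter> B \<inter> C) h" ..
  define k where "k = piece_index L h"
  define E where "E = L k \<inter> (\<Union>j<k. L j)"
  have hABC: "h \<in> A \<inter> B \<inter> C"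
    using h unfolding is_least_def by simp
  then obtain k0 where k0: "k0 < N" "h \<in> L k0"
    using sub(1) by blast
  then have hk: "h \<in> L k" "k < N"
    using in_piece_index[of h L "{..<N}"] piece_index_le[of h L k0] unfolding k_def by auto
  have hE: "h \<notin> (\<Union>j<k. L j)"
    using not_in_earlier_piece[of _ L h] unfolding k_def by auto
  have comp: "compact (L j)" if "j < N" for j
    using L that unfolding tree_of_convex_sets_def by blast
  have "convex E"
    using L hk(2) unfolding E_def tree_of_convex_sets_def by blast
  have "closed (L j)" if "j \<le> k" for j
    using comp hk(2) that by (simp add: compact_imp_closed)
  then have "closed E"
    unfolding E_def by (intro closed_Int closed_UN) simp_all
  \<comment> \<open>Gate points are included although their index is below \<open>k\<close>: they
    have distance 0 to \<open>E\<close>, while \<open>h\<close> is off the closed set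
    \<open>E\<close>.\<close>
  define lower where "lower = {x \<in> L k. infdist x E < infdist h E \<or> infdist x E = infdist h E \<and> norm x < norm h}"
  have "convex lower"
    unfolding lower_def using L hk(2) \<open>convex E\<close> unfolding tree_of_convex_sets_def
    by (intro convex_lex_sublevel) auto
  have "(A \<inter> L k) \<inter> (B \<inter> L k) \<inter> (C \<inter> L k) \<inter> lower = {}"
  proof (rule ccontr)
    assume "(A \<inter> L k) \<inter> (B \<inter> L k) \<inter> (C \<inter> L k) \<inter> lower \<noteq> {}"
    then obtain y where y: "y \<in> A \<inter> B \<inter> C" "y \<in> lower" "y \<in> L k"
      by blast
    then have "y \<noteq> h"
      unfolding lower_def by auto
    then have "tree_less L h y"
      using h y(1) unfolding is_least_def by blast
    moreover have "piece_index L y \<le> k"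
      using y(3) by (rule piece_index_le)
    ultimately show False
      using y(2) unfolding tree_less_def lower_def E_def k_def by (auto simp: Let_def)
  qed
  moreover have "(A \<inter> L k) \<inter> (B \<inter> L k) \<inter> (C \<inter> L k) \<noteq> {}"
    using hABC hk by blast
  ultimately have some_pair: "(A \<inter> L k) \<inter> (B \<inter> L k) \<inter> lower = {} \<or> (A \<inter> L k) \<inter> (C \<inter> L k) \<inter> lower = {}
      \<or> (B \<inter> L k) \<inter> (C \<inter> L k) \<inter> lower = {}"
    using Helly_four[OF dim, of "A \<inter> L k" "B \<inter> L k" "C \<inter> L k" lower] A B C hk(2) \<open>convex lower\<close> by blast
  have pair: "is_least (tree_less L) (S \<inter> T) h"
    if empty: "(S \<inter> L k) \<inter> (T \<inter> L k) \<inter> lower = {}" and hS: "h \<in> S" "h \<in> T"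
      and SN: "S \<subseteq> (\<Union>k<N. L k)"
      and S: "\<And>k. k < N \<Longrightarrow> compact (S \<inter> L k) \<and> convex (S \<inter> L k)"
      and T: "\<And>k. k < N \<Longrightarrow> compact (T \<inter> L k) \<and> convex (T \<inter> L k)"
      and gate: "S \<inter> T \<inter> L k \<noteq> {} \<Longrightarrow> S \<inter> T \<inter> (\<Union>j<k. L j) \<noteq> {} \<Longrightarrow> S \<inter> T \<inter> (L k \<inter> (\<Union>j<k. L j)) \<noteq> {}"
    for S T
  proof -
    have "\<exists>m. is_least (tree_less L) (S \<inter> T) m"
      using ex_least_tree_less[OF L, of "S \<inter> T"] S T conv SN hS by blast
    then obtain m where m: "is_least (tree_less L) (S \<inter> T) m" ..
    have "m = h"
    proof (rule ccontr)
      assume "m \<noteq> h"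
      then have less: "tree_less L m h"
        using m hS unfolding is_least_def by auto
      have mST: "m \<in> S \<inter> T"
        using m unfolding is_least_def by blast
      then have mi: "m \<in> L (piece_index L m)"
        using in_piece_index[of m L "{..<N}"] SN by blast
      show False
      proof (cases "piece_index L m = k")
        case True
        then have "m \<in> lower"
          using less mi unfolding lower_def tree_less_def E_def k_def by (auto simp: Let_def)
        then show False
          using empty mST mi True by blast
      next
        case False
        \<comment> \<open>Now \<open>m\<close> lies in an earlier piece and \<open>h\<close> in
          \<open>L k\<close>, so the gate hypothesis provides a point of \<open>E\<close>.\<close>
        then have "S \<inter> T \<inter> (\<Union>j<k. L j) \<noteq> {}"
          using less mi mST unfolding tree_less_def k_def by (auto simp: Let_def)
        then obtain g where g: "g \<in> S \<inter> T" "g \<in> E"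
          using gate hS hk unfolding E_def by blast
        then have "infdist g E = 0" "0 < infdist h E"
          using hE infdist_pos_not_in_closed[OF \<open>closed E\<close>, of h] unfolding E_def by auto
        then have "g \<in> lower"
          using g unfolding lower_def E_def by auto
        then show False
          using empty g unfolding E_def by blast
      qed
    qed
    then show ?thesis
      using m by simp
  qed
  have hA: "h \<in> A" and hB: "h \<in> B" and hC: "h \<in> C"
    using hABC by auto
  have AB: "is_least (tree_less L) (A \<inter> B) h" if "(A \<inter> L k) \<inter> (B \<inter> L k) \<inter> lower = {}"
    by (rule pair[OF that hA hB sub(1)]) (use A B gateAB[OF hk(2)] in blast)+
  have AC: "is_least (tree_less L) (A \<inter> C) h" if "(A \<inter> L k) \<inter> (C \<inter> L k) \<inter> lower = {}"
    by (rule pair[OF that hA hC sub(1)]) (use A C gateAC[OF hk(2)] in blast)+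
  have BC: "is_least (tree_less L) (B \<inter> C) h" if "(B \<inter> L k) \<inter> (C \<inter> L k) \<inter> lower = {}"
    by (rule pair[OF that hB hC sub(2)]) (use B C gateBC[OF hk(2)] in blast)+
  from some_pair AB AC BC have "is_least (tree_less L) (A \<inter> B) h \<or> is_least (tree_less L) (A \<inter> C) h
      \<or> is_least (tree_less L) (B \<inter> C) h"
    by argo
  with hABC show ?thesis
    by (rule bexI[rotated])
qed

text \<open>If \<open>A\<close> and \<open>B\<close> separate \<open>S\<close>, the connected set
  \<open>S \<inter> T\<close> misses one of them, say \<open>B\<close>; then
  \<open>A \<union> T\<close> and \<open>B\<close> separate \<open>S \<union> T\<close>.\<close>

lemma connected_of_connected_Un_Int:
  fixes S T :: "'a::topological_space set"
  assumes "closed S" "closed T" "connected (S \<union> T)" "connected (S \<inter> T)"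
  shows "connected S"
proof (rule ccontr)
  assume "\<not> connected S"
  then obtain A B where AB: "closed A" "closed B" "A \<noteq> {}" "B \<noteq> {}" "A \<union> B = S" "A \<inter> B = {}"
    using connected_closed_set[OF assms(1)] by blast
  have False if "closed A" "closed B" "A \<noteq> {}" "B \<noteq> {}" "A \<union> B = S" "A \<inter> B = {}" "B \<inter> (S \<inter> T) = {}" for A B
  proof -
    have "closed (A \<union> T)" "(A \<union> T) \<inter> B = {}" "(A \<union> T) \<union> B = S \<union> T" "A \<union> T \<noteq> {}"
      using that assms(2) by auto
    then show False
      using connected_closed_set[of "S \<union> T"] assms(1-3) that by blast
  qed
  moreover have "A \<inter> (S \<inter> T) = {} \<or> B \<inter> (S \<inter> T) = {}"
    using connected_closedD[OF assms(4), of A B] AB by blast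
  ultimately show False
    using AB by (metis Int_commute Un_commute)
qed

text \<open>The point to settle is the gate condition. Removing pieces from the last to the first
  keeps \<open>A p \<inter> A q\<close> connected, because its trace on each gate is convex. A
  connected subset of the first \<open>k + 1\<close> pieces that meets both \<open>L k\<close> and
  the earlier ones must meet the gate, all parts being closed.\<close>

lemma colorful_Helly_tree_of_convex_sets:
  fixes L :: "nat \<Rightarrow> 'a::euclidean_space set" and A :: "'b \<Rightarrow> 'a set" and P :: "nat \<Rightarrow> 'b set"
  assumes dim: "DIM('a) = 2" and L: "tree_of_convex_sets L N"
    and A: "\<And>p k. p \<in> P 1 \<union> P 2 \<union> P 3 \<Longrightarrow> k < N \<Longrightarrow> compact (A p \<inter> L k) \<and> convex (A p \<inter> L k)"
    and sub: "\<And>p. p \<in> P 1 \<union> P 2 \<union> P 3 \<Longrightarrow> A p \<subseteq> (\<Union>k<N. L k)"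
    and conn: "\<And>p q. p \<in> P 1 \<union> P 2 \<union> P 3 \<Longrightarrow> q \<in> P 1 \<union> P 2 \<union> P 3 \<Longrightarrow> connected (A p \<inter> A q)"
    and P: "\<And>i. i \<in> {1, 2, 3} \<Longrightarrow> finite (P i) \<and> P i \<noteq> {}"
    and ne: "\<And>p q r. p \<in> P 1 \<Longrightarrow> q \<in> P 2 \<Longrightarrow> r \<in> P 3 \<Longrightarrow> A p \<inter> A q \<inter> A r \<noteq> {}"
  shows "\<exists>i\<in>{1, 2, 3}. \<exists>x. \<forall>p\<in>P i. x \<in> A p"
proof -
  have comp: "compact (L j)" if "j < N" for j
    using L that unfolding tree_of_convex_sets_def by blast
  have clo: "closed (\<Union>j<k. L j)" if "k \<le> N" for k
    using comp that by (intro closed_UN) (auto intro!: compact_imp_closed)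
  let ?P = "P 1 \<union> P 2 \<union> P 3"
  have convex2: "compact (A p \<inter> A q \<inter> L k) \<and> convex (A p \<inter> A q \<inter> L k)"
    if "p \<in> ?P" "q \<in> ?P" "k < N" for p q k
  proof -
    have "A p \<inter> A q \<inter> L k = (A p \<inter> L k) \<inter> (A q \<inter> L k)" by blast
    then show ?thesis
      using A[OF that(1,3)] A[OF that(2,3)] by (simp add: compact_Int convex_Int)
  qed
  have clo2: "closed (A p \<inter> A q \<inter> (\<Union>j<k. L j))" if "p \<in> ?P" "q \<in> ?P" "k \<le> N" for p q k
  proof -
    have "A p \<inter> A q \<inter> (\<Union>j<k. L j) = (\<Union>j<k. A p \<inter> A q \<inter> L j)" by blast
    moreover have "closed (A p \<inter> A q \<inter> L j)" if "j < k" for j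
      using convex2[of p q j] \<open>p \<in> ?P\<close> \<open>q \<in> ?P\<close> \<open>k \<le> N\<close> that by (simp add: compact_imp_closed)
    then have "closed (\<Union>j<k. A p \<inter> A q \<inter> L j)"
      by (intro closed_UN) auto
    ultimately show ?thesis
      by (simp only:)
  qed
  \<comment> \<open>Induction on the number \<open>d\<close> of removed pieces. From
    \<open>d = N\<close> on, the truncated difference stays 0.\<close>
  have conn_part: "connected (A p \<inter> A q \<inter> (\<Union>j<N - d. L j))" if pq: "p \<in> ?P" "q \<in> ?P" for p q d
  proof (induction d)
    case 0
    have "A p \<inter> A q \<inter> (\<Union>j<N. L j) = A p \<inter> A q"
      using sub pq by blast
    then show ?case
      using conn pq by simp
  next
    case (Suc d)
    show ?case
    proof (cases "d < N")
      case True
      define k where "k = N - Suc d"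
      have k: "N - d = Suc k" "k < N"
        using True unfolding k_def by auto
      let ?C = "A p \<inter> A q"
      have "connected (?C \<inter> (\<Union>j<k. L j))"
      proof (rule connected_of_connected_Un_Int)
        show "closed (?C \<inter> (\<Union>j<k. L j))"
          using clo2 pq k by simp
        show "closed (?C \<inter> L k)"
          using convex2 pq k by (simp add: compact_imp_closed)
        have "?C \<inter> (\<Union>j<k. L j) \<union> ?C \<inter> L k = ?C \<inter> (\<Union>j<Suc k. L j)"
          by (auto simp: less_Suc_eq)
        then show "connected (?C \<inter> (\<Union>j<k. L j) \<union> ?C \<inter> L k)"
          using Suc k by simp
        have "?C \<inter> (\<Union>j<k. L j) \<inter> (?C \<inter> L k) = (?C \<inter> L k) \<inter> (L k \<inter> (\<Union>j<k. L j))"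
          by blast
        then show "connected (?C \<inter> (\<Union>j<k. L j) \<inter> (?C \<inter> L k))"
          using convex2[OF pq k(2)] L k(2) unfolding tree_of_convex_sets_def
          by (simp add: convex_Int convex_connected)
      qed
      then show ?thesis
        by (simp add: k_def)
    next
      case False
      then show ?thesis by simp
    qed
  qed
  have gate: "A p \<inter> A q \<inter> (L k \<inter> (\<Union>j<k. L j)) \<noteq> {}"
    if pq: "p \<in> ?P" "q \<in> ?P" "k < N" "A p \<inter> A q \<inter> L k \<noteq> {}" "A p \<inter> A q \<inter> (\<Union>j<k. L j) \<noteq> {}" for p q k
  proof -
    define S where "S = A p \<inter> A q \<inter> L k"
    define T where "T = A p \<inter> A q \<inter> (\<Union>j<k. L j)"
    have "closed S" "closed T"
      unfolding S_def T_def using convex2 clo2 pq by (simp_all add: compact_imp_closed)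
    moreover have "A p \<inter> A q \<inter> (\<Union>j<Suc k. L j) = S \<union> T"
      unfolding S_def T_def by (auto simp: less_Suc_eq)
    then have "connected (S \<union> T)"
      using conn_part[OF pq(1,2), of "N - Suc k"] pq(3) by simp
    moreover have "S \<noteq> {}" "T \<noteq> {}"
      using pq(4,5) unfolding S_def T_def by auto
    ultimately have "S \<inter> T \<noteq> {}"
      using connected_closedD[of "S \<union> T" S T] by auto
    moreover have "S \<inter> T = A p \<inter> A q \<inter> (L k \<inter> (\<Union>j<k. L j))"
      unfolding S_def T_def by auto
    ultimately show ?thesis
      by simp
  qed
  have ne': "A p \<inter> A q \<inter> A r \<noteq> {}" if "{i, j, k} = {1, 2, 3}" "p \<in> P i" "q \<in> P j" "r \<in> P k" for i j k :: nat and p q r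
  proof -
    have "i \<in> {1, 2, 3}" "j \<in> {1, 2, 3}" "k \<in> {1, 2, 3}"
      using that(1) by blast+
    moreover have "card {i, j, k} = 3"
      using that(1) by simp
    then have "i \<noteq> j" "i \<noteq> k" "j \<noteq> k"
      by (auto simp: card_insert_if split: if_splits)
    ultimately consider "i = 1" "j = 2" "k = 3" | "i = 1" "j = 3" "k = 2" | "i = 2" "j = 1" "k = 3"
      | "i = 2" "j = 3" "k = 1" | "i = 3" "j = 1" "k = 2" | "i = 3" "j = 2" "k = 1"
      by fast
    then show ?thesis
      using that(2-4)
      by cases (use ne[of p q r] ne[of p r q] ne[of q p r] ne[of q r p] ne[of r p q] ne[of r q p] in \<open>simp_all add: Int_ac\<close>)
  qed
  show ?thesis
  proof (rule colorful_of_least_elements[OF transp_tree_less asymp_tree_less P])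
    fix i j p q
    assume ij: "i \<in> {1, 2, 3::nat}" "j \<in> {1, 2, 3}" "i \<noteq> j" "p \<in> P i" "q \<in> P j"
    then have pq: "p \<in> ?P" "q \<in> ?P"
      by auto
    \<comment> \<open>A point \<open>r\<close> of the remaining colour exists, so the hypothesis on
      triples shows that the pair intersects.\<close>
    define k where "k = 6 - i - j"
    have k: "k \<in> {1, 2, 3}" "{i, j, k} = {1, 2, 3}"
      using ij unfolding k_def by auto
    then obtain r where "r \<in> P k"
      using P by blast
    then have "A p \<inter> A q \<noteq> {}"
      using ne'[OF k(2) ij(4,5)] by blast
    then show "\<exists>m. is_least (tree_less L) (A p \<inter> A q) m"
      using ex_least_tree_less[OF L, of "A p \<inter> A q"] convex2[OF pq] sub[OF pq(1)] by blast
  next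
    fix i j k p q r
    assume ijk: "{i, j, k} = {1, 2, 3::nat}" "p \<in> P i" "q \<in> P j" "r \<in> P k"
    then have "i \<in> {1, 2, 3}" "j \<in> {1, 2, 3}" "k \<in> {1, 2, 3}"
      by blast+
    then have pqr: "p \<in> ?P" "q \<in> ?P" "r \<in> ?P"
      using ijk by auto
    show "\<exists>h \<in> A p \<inter> A q \<inter> A r. is_least (tree_less L) (A p \<inter> A q) h \<or> is_least (tree_less L) (A p \<inter> A r) h
                     \<or> is_least (tree_less L) (A q \<inter> A r) h"
      by (rule least_of_triple_is_least_of_pair[OF dim L]) (use A sub gate ne'[OF ijk] pqr in auto)
  qed
qed

section \<open>Visibility in planar sets without holes\<close>

text \<open>The connected set \<open>- X\<close> is unbounded, so it meets the complement of the
  bounded set \<open>T\<close>. If it also met \<open>T\<close>, it would meet the frontier of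
  \<open>T\<close>, which lies in \<open>X\<close>.\<close>

lemma subset_of_frontier_subset:
  fixes X T :: "'a::{real_normed_vector, perfect_space} set"
  assumes "compact X" "connected (- X)" "bounded T" "frontier T \<subseteq> X"
  shows "T \<subseteq> X"
proof (rule ccontr)
  assume "\<not> T \<subseteq> X"
  then have "- X \<inter> T \<noteq> {}"
    by blast
  moreover have "bounded (X \<union> T)"
    using assms by (simp add: compact_imp_bounded)
  then have "X \<union> T \<noteq> UNIV"
    using not_bounded_UNIV by metis
  then have "- X - T \<noteq> {}"
    by blast
  ultimately show False
    using connected_Int_frontier[OF assms(2)] assms(4) by blast
qed

lemma triangle_subset:
  fixes X :: "complex set"
  assumes "compact X" "connected (- X)"
    and "closed_segment a b \<subseteq> X" "closed_segment b c \<subseteq> X" "closed_segment c a \<subseteq> X"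
  shows "convex hull {a, b, c} \<subseteq> X"
proof (rule subset_of_frontier_subset[OF assms(1,2)])
  show "bounded (convex hull {a, b, c})"
    by (simp add: bounded_convex_hull)
  show "frontier (convex hull {a, b, c}) \<subseteq> X"
    using assms by (simp add: frontier_of_triangle)
qed

lemma triangle_sees:
  fixes X :: "complex set"
  assumes "compact X" "connected (- X)"
    and "closed_segment a b \<subseteq> X" "closed_segment b c \<subseteq> X" "closed_segment c a \<subseteq> X"
    and "x \<in> convex hull {a, b, c}" "y \<in> convex hull {a, b, c}"
  shows "sees X x y"
  using triangle_subset[OF assms(1-5)] assms(6,7) closed_segment_subset[OF assms(6,7)]
  unfolding sees_def by auto

text \<open>\<open>x\<close> and \<open>y\<close> lie on weakly opposite sides of the line \<open>pq\<close>; since \<open>z / 0 = 0\<close>, this holds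
  trivially for \<open>p = q\<close>.\<close>

definition opposite :: "complex \<Rightarrow> complex \<Rightarrow> complex \<Rightarrow> complex \<Rightarrow> bool" where
  "opposite p q x y \<longleftrightarrow> Im ((x - p) / (q - p)) * Im ((y - p) / (q - p)) \<le> 0"

lemma oppositeI:
  assumes "0 \<le> b" "0 \<le> c" "0 < b + c" "b * Im ((x - p) / (q - p)) + c * Im ((y - p) / (q - p)) = 0"
  shows "opposite p q x y"
proof (rule ccontr)
  define s where "s = Im ((x - p) / (q - p))"
  define t where "t = Im ((y - p) / (q - p))"
  assume "\<not> opposite p q x y"
  then have "0 < s * t"
    unfolding opposite_def s_def t_def by simp
  then consider "0 < s" "0 < t" | "s < 0" "t < 0"
    by (auto simp: zero_less_mult_iff)
  then show False
  proof cases
    case 1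
    then have "0 < b * s + c * t"
      using assms(1-3) by (cases "b = 0") (auto intro: add_pos_nonneg)
    then show False
      using assms(4) unfolding s_def t_def by simp
  next
    case 2
    then have "b * s \<le> 0" "c * t \<le> 0" "b * s < 0 \<or> c * t < 0"
      using assms(1-3) by (auto simp: mult_nonneg_nonpos mult_less_0_iff)
    then show False
      using assms(4) unfolding s_def t_def by simp
  qed
qed

lemma Im_combination_divide:
  "b * Im (u / d) + c * Im (v / d) = Im ((b *\<^sub>R u + c *\<^sub>R v) / d)"
proof -
  have "(b *\<^sub>R u + c *\<^sub>R v) / d = b *\<^sub>R (u / d) + c *\<^sub>R (v / d)"
    by (simp add: add_divide_distrib scaleR_conv_of_real)
  then show ?thesis
    by simp
qed

lemma Im_scaleR_divide_self: "Im (s *\<^sub>R d / d) = 0"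
  by (cases "d = 0") (simp_all add: scaleR_conv_of_real)

text \<open>The line from the vertex \<open>q\<close> through \<open>p\<close> crosses the side from
  \<open>x\<close> to \<open>y\<close>: weighting the heights of \<open>x\<close> and
  \<open>y\<close> over this line with their barycentric coordinates gives 0. Both orders of
  \<open>p\<close> and \<open>q\<close> are recorded since \<open>opposite\<close> is normalised at
  its first argument.\<close>

lemma opposite_if_in_triangle:
  assumes "p \<in> convex hull {q, x, y}" "p \<noteq> q"
  shows "opposite p q x y" "opposite q p x y"
proof -
  obtain a b c where abc: "0 \<le> a" "0 \<le> b" "0 \<le> c" "a + b + c = 1" "p = a *\<^sub>R q + b *\<^sub>R x + c *\<^sub>R y"
    using assms(1) unfolding convex_hull_3 by blast
  have a: "a = 1 - b - c"
    using abc(4) by simp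
  have bc: "0 < b + c"
  proof (rule ccontr)
    assume "\<not> 0 < b + c"
    then have "b = 0" "c = 0"
      using abc by auto
    then show False
      using abc assms(2) by simp
  qed
  have 1: "b *\<^sub>R (x - p) + c *\<^sub>R (y - p) = (b + c - 1) *\<^sub>R (q - p)"
    using abc(5) unfolding a by (simp add: algebra_simps)
  have "b * Im ((x - p) / (q - p)) + c * Im ((y - p) / (q - p)) = Im ((b *\<^sub>R (x - p) + c *\<^sub>R (y - p)) / (q - p))"
    by (rule Im_combination_divide)
  also have "\<dots> = 0"
    unfolding 1 by (rule Im_scaleR_divide_self)
  finally show "opposite p q x y"
    using oppositeI[OF abc(2,3) bc] by blast
  have 2: "b *\<^sub>R (x - q) + c *\<^sub>R (y - q) = p - q"
    using abc(5) unfolding a by (simp add: algebra_simps)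
  have "b * Im ((x - q) / (p - q)) + c * Im ((y - q) / (p - q)) = Im ((b *\<^sub>R (x - q) + c *\<^sub>R (y - q)) / (p - q))"
    by (rule Im_combination_divide)
  also have "\<dots> = 0"
    unfolding 2 using assms(2) by simp
  finally show "opposite q p x y"
    using oppositeI[OF abc(2,3) bc] by blast
qed

text \<open>The common point has height 0 over the line \<open>pq\<close>, and its height is an
  average of those of \<open>x\<close> and \<open>y\<close>.\<close>

lemma opposite_if_segments_meet:
  assumes "closed_segment p q \<inter> closed_segment x y \<noteq> {}"
  shows "opposite p q x y"
proof -
  obtain s t where st: "0 \<le> s" "s \<le> 1" "0 \<le> t" "t \<le> 1"
    "(1 - s) *\<^sub>R p + s *\<^sub>R q = (1 - t) *\<^sub>R x + t *\<^sub>R y"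
    using assms unfolding closed_segment_def by blast
  have 1: "(1 - t) *\<^sub>R (x - p) + t *\<^sub>R (y - p) = s *\<^sub>R (q - p)"
    using st(5) by (simp add: algebra_simps)
  have "(1 - t) * Im ((x - p) / (q - p)) + t * Im ((y - p) / (q - p)) = Im (((1 - t) *\<^sub>R (x - p) + t *\<^sub>R (y - p)) / (q - p))"
    by (rule Im_combination_divide)
  also have "\<dots> = 0"
    unfolding 1 by (rule Im_scaleR_divide_self)
  finally show ?thesis
    using oppositeI[of "1 - t" t] st by simp
qed

text \<open>By Radon's theorem four points of the plane split into two classes with intersecting
  hulls. A split into one and three points, or into \<open>{p, q}\<close> and \<open>{x, y}\<close>,
  makes a pair opposite; the remaining splits are the two crossings.\<close>

lemma four_points_cases:
  fixes p q x y :: complex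
  obtains "opposite p q x y" | "opposite x y p q" | "closed_segment p x \<inter> closed_segment q y \<noteq> {}"
    | "closed_segment p y \<inter> closed_segment q x \<noteq> {}"
proof (cases "distinct [p, q, x, y]")
  \<comment> \<open>When two points coincide, one of the quotients in a suitable
    \<open>opposite\<close> is 0 or 1 and so has imaginary part 0.\<close>
  case False
  then have "opposite p q x y \<or> opposite x y p q"
    unfolding opposite_def by auto
  then show thesis
    using that by blast
next
  case True
  then have "affine_dependent {p, q, x, y}"
    by (intro affine_dependent_biggerset) auto
  then obtain M0 P0 where MP0: "M0 \<inter> P0 = {}" "M0 \<union> P0 = {p, q, x, y}" "convex hull M0 \<inter> convex hull P0 \<noteq> {}"
    using Radon_partition[of "{p, q, x, y}"] by auto
  \<comment> \<open>The two classes are interchangeable; \<open>M\<close> is the one containing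
    \<open>p\<close>.\<close>
  then obtain M P where MP: "M \<inter> P = {}" "M \<union> P = {p, q, x, y}" "convex hull M \<inter> convex hull P \<noteq> {}" "p \<in> M"
    by (metis Int_commute Un_commute Un_iff insertI1)
  then have P: "P = {p, q, x, y} - M" "M \<subseteq> {p, q, x, y}"
    by blast+
  have neq: "p \<noteq> q" "q \<noteq> p" "x \<noteq> y" "y \<noteq> x"
    using True by auto
  consider "M = {p}" | "M = {p, q}" | "M = {p, x}" | "M = {p, y}" | "M = {p, q, x}" | "M = {p, q, y}"
    | "M = {p, x, y}" | "M = {p, q, x, y}"
    using P(2) MP(4) by (cases "q \<in> M"; cases "x \<in> M"; cases "y \<in> M") blast+
  then show thesis
  proof cases
    case 1
    moreover then have "P = {q, x, y}" using P True by auto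
    ultimately have "p \<in> convex hull {q, x, y}" using MP(3) by simp
    then show thesis using opposite_if_in_triangle[of p q x y] neq that(1) by simp
  next
    case 2
    moreover then have "P = {x, y}" using P True by auto
    ultimately show thesis using MP(3) opposite_if_segments_meet that(1) by (simp add: segment_convex_hull)
  next
    case 3
    moreover then have "P = {q, y}" using P True by auto
    ultimately show thesis using MP(3) that(3) by (simp add: segment_convex_hull)
  next
    case 4
    moreover then have "P = {q, x}" using P True by auto
    ultimately show thesis using MP(3) that(4) by (simp add: segment_convex_hull)
  next
    case 5
    moreover then have "P = {y}" using P True by auto
    ultimately have "y \<in> convex hull {x, p, q}" using MP(3) by (simp add: insert_commute)
    then show thesis using opposite_if_in_triangle(2)[of y x p q] neq that(2) by simp
  next
    case 6
    moreover then have "P = {x}" using P True by auto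
    ultimately have "x \<in> convex hull {y, p, q}" using MP(3) by (simp add: insert_commute)
    then show thesis using opposite_if_in_triangle(1)[of x y p q] neq that(2) by simp
  next
    case 7
    moreover then have "P = {q}" using P True by auto
    ultimately have "q \<in> convex hull {p, x, y}" using MP(3) by simp
    then show thesis using opposite_if_in_triangle(2)[of q p x y] neq that(1) by simp
  next
    case 8
    then have "P = {}" using P by auto
    then show thesis using MP(3) by simp
  qed
qed

text \<open>The affine map \<open>w\<close> sends \<open>p\<close> to 0 and \<open>q\<close> to 1.
  The barycentric coordinates of \<open>v\<close> at \<open>x\<close>, \<open>q\<close> and
  \<open>p\<close> are \<open>l v\<close>, \<open>m v\<close> and
  \<open>1 - l v - m v\<close>.\<close>

lemma in_triangle_barycentric:
  fixes p q x v :: complex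
  defines "w \<equiv> \<lambda>v. (v - p) / (q - p)"
  defines "l \<equiv> \<lambda>v. Im (w v) / Im (w x)"
  defines "m \<equiv> \<lambda>v. Re (w v) - l v * Re (w x)"
  assumes "Im (w x) \<noteq> 0" "0 \<le> l v" "0 \<le> m v" "l v + m v \<le> 1"
  shows "v \<in> convex hull {p, q, x}"
proof -
  have pq: "p \<noteq> q"
    using assms(4) unfolding w_def by auto
  have "w v = m v + l v * w x"
    unfolding m_def using assms(4) by (auto simp: complex_eq_iff l_def)
  then have "w v * (q - p) = m v * (q - p) + l v * (w x * (q - p))"
    by (simp add: algebra_simps)
  moreover have "w u * (q - p) = u - p" for u
    using pq unfolding w_def by simp
  ultimately have "v - p = m v *\<^sub>R (q - p) + l v *\<^sub>R (x - p)"
    by (simp add: scaleR_conv_of_real)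
  then have "v = (1 - l v - m v) *\<^sub>R p + m v *\<^sub>R q + l v *\<^sub>R x"
    by (simp add: algebra_simps)
  moreover have "0 \<le> 1 - l v - m v" "(1 - l v - m v) + m v + l v = 1"
    using assms(7) by auto
  ultimately show ?thesis
    unfolding convex_hull_3 using assms(5,6) by blast
qed

text \<open>On the open segment the coordinates at \<open>p\<close> and \<open>q\<close> are
  positive and the third is 0, for both triangles. On the open set \<open>U\<close> the first two
  stay positive, and the sign of \<open>Im (w v)\<close> selects the triangle for which the third is
  nonnegative.\<close>

lemma open_segment_subset_interior_triangles:
  assumes "0 < Im ((x - p) / (q - p))" "Im ((y - p) / (q - p)) < 0"
  shows "open_segment p q \<subseteq> interior (convex hull {p, q, x} \<union> convex hull {p, q, y})"
proof -
  define w where "w v = (v - p) / (q - p)" for v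
  define l where "l a v = Im (w v) / Im (w a)" for a v
  define m where "m a v = Re (w v) - l a v * Re (w a)" for a v
  define U where "U = {v. \<forall>a\<in>{x, y}. 0 < m a v \<and> l a v + m a v < 1}"
  have pq: "p \<noteq> q"
    using assms by auto
  have cont: "continuous_on UNIV (l a)" "continuous_on UNIV (m a)" if "a \<in> {x, y}" for a
    unfolding l_def m_def w_def using assms that by (auto intro!: continuous_intros)
  have "U = (\<Inter>a\<in>{x, y}. {v. 0 < m a v} \<inter> {v. l a v + m a v < 1})"
    unfolding U_def by auto
  moreover have "open {v. 0 < m a v}" "open {v. l a v + m a v < 1}" if "a \<in> {x, y}" for a
    using cont[OF that] by (auto intro!: open_Collect_less continuous_intros)
  ultimately have "open U"
    by (auto intro!: open_INT open_Int)
  moreover have "U \<subseteq> convex hull {p, q, x} \<union> convex hull {p, q, y}"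
  proof
    fix v assume v: "v \<in> U"
    show "v \<in> convex hull {p, q, x} \<union> convex hull {p, q, y}"
    proof (cases "0 \<le> Im (w v)")
      case True
      then have "v \<in> convex hull {p, q, x}"
        using in_triangle_barycentric[of x p q v] v assms unfolding U_def m_def l_def w_def by simp
      then show ?thesis ..
    next
      case False
      then have "v \<in> convex hull {p, q, y}"
        using in_triangle_barycentric[of y p q v] v assms unfolding U_def m_def l_def w_def
        by (simp add: divide_nonpos_neg)
      then show ?thesis ..
    qed
  qed
  moreover have "open_segment p q \<subseteq> U"
  proof
    fix v assume "v \<in> open_segment p q"
    then obtain t where t: "0 < t" "t < 1" "v = (1 - t) *\<^sub>R p + t *\<^sub>R q"
      unfolding in_segment by blast
    have "v - p = t *\<^sub>R (q - p)"
      using t by (simp add: algebra_simps)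
    then have "w v = t"
      using pq unfolding w_def by (simp add: scaleR_conv_of_real)
    then show "v \<in> U"
      using t unfolding U_def m_def l_def by simp
  qed
  ultimately show ?thesis
    by (meson interior_maximal order_trans)
qed

text \<open>The triangles lie on different sides of \<open>pq\<close> and form a quadrilateral,
  perhaps not convex. Its interior contains the open diagonal, so its frontier lies on the four
  sides and the whole quadrilateral in \<open>X\<close>.\<close>

lemma diagonal_subset_signed:
  fixes X :: "complex set"
  assumes X: "compact X" "connected (- X)"
    and sides: "closed_segment p x \<subseteq> X" "closed_segment q x \<subseteq> X" "closed_segment p y \<subseteq> X" "closed_segment q y \<subseteq> X"
    and sign: "0 < Im ((x - p) / (q - p))" "Im ((y - p) / (q - p)) < 0"
  shows "closed_segment p q \<subseteq> X"
proof -
  let ?D = "convex hull {p, q, x} \<union> convex hull {p, q, y}"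
  have "?D \<subseteq> X"
  proof (rule subset_of_frontier_subset[OF X])
    show "bounded ?D"
      by (simp add: bounded_convex_hull)
    have "frontier ?D \<subseteq> (frontier (convex hull {p, q, x}) \<union> frontier (convex hull {p, q, y})) - interior ?D"
      using frontier_Un_subset[of "convex hull {p, q, x}" "convex hull {p, q, y}"]
      by (auto simp: frontier_def[of ?D])
    also have "\<dots> \<subseteq> (closed_segment p q - open_segment p q) \<union> X"
      using sides open_segment_subset_interior_triangles[OF sign]
      by (auto simp: frontier_of_triangle closed_segment_commute)
    also have "\<dots> \<subseteq> X"
      using sides by (auto simp: open_segment_def)
    finally show "frontier ?D \<subseteq> X" .
  qed
  moreover have "closed_segment p q \<subseteq> convex hull {p, q, x}"
    by (simp add: segment_convex_hull hull_mono)
  ultimately show ?thesis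
    by blast
qed

lemma segment_subset_of_collinear:
  assumes "Im ((x - p) / (q - p)) = 0"
  shows "closed_segment p q \<subseteq> closed_segment p x \<union> closed_segment q x"
proof (cases "p = q")
  case False
  define s where "s = Re ((x - p) / (q - p))"
  have "(x - p) / (q - p) = s"
    using assms unfolding s_def by (simp add: complex_eq_iff)
  then have "x = p + s *\<^sub>R (q - p)"
    using False by (simp add: field_simps scaleR_conv_of_real)
  then have "x = (1 - s) *\<^sub>R p + (1 - (1 - s)) *\<^sub>R q"
    by (simp add: algebra_simps)
  then have "collinear {p, x, q}"
    unfolding collinear_3_expand by blast
  then have "collinear {p, q, x}"
    by (simp add: insert_commute)
  then consider "p \<in> closed_segment q x" | "q \<in> closed_segment x p" | "x \<in> closed_segment p q"
    unfolding collinear_between_cases between_mem_segment by blast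
  then show ?thesis
  proof cases
    case 1
    then have "closed_segment p q \<subseteq> closed_segment q x"
      by (simp add: subset_closed_segment)
    then show ?thesis by blast
  next
    case 2
    then have "closed_segment p q \<subseteq> closed_segment p x"
      by (simp add: subset_closed_segment closed_segment_commute)
    then show ?thesis by blast
  next
    case 3
    then show ?thesis
      using Un_closed_segment[OF 3] by (simp add: closed_segment_commute)
  qed
qed simp

lemma diagonal_subset:
  fixes X :: "complex set"
  assumes X: "compact X" "connected (- X)"
    and sides: "closed_segment p x \<subseteq> X" "closed_segment q x \<subseteq> X" "closed_segment p y \<subseteq> X" "closed_segment q y \<subseteq> X"
    and "opposite p q x y"
  shows "closed_segment p q \<subseteq> X"
proof -
  define s where "s = Im ((x - p) / (q - p))"
  define t where "t = Im ((y - p) / (q - p))"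
  have "s = 0 \<or> t = 0 \<or> 0 < s \<and> t < 0 \<or> s < 0 \<and> 0 < t"
    using assms(7) unfolding opposite_def s_def[symmetric] t_def[symmetric] by (auto simp: mult_le_0_iff)
  then consider "s = 0" | "t = 0" | "0 < s" "t < 0" | "s < 0" "0 < t"
    by blast
  then show ?thesis
  proof cases
    case 1
    then show ?thesis
      using segment_subset_of_collinear[of x p q] sides unfolding s_def by blast
  next
    case 2
    then show ?thesis
      using segment_subset_of_collinear[of y p q] sides unfolding t_def by blast
  next
    case 3
    then show ?thesis
      using diagonal_subset_signed[OF X sides] unfolding s_def t_def by blast
  next
    case 4
    then show ?thesis
      using diagonal_subset_signed[OF X sides(3,4,1,2)] unfolding s_def t_def by blast
  qed
qed

section \<open>Topology and convexity of visibility sets\<close>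

text \<open>Let \<open>x\<close> and \<open>y\<close> both see \<open>p\<close> and
  \<open>q\<close>. If \<open>pq\<close> is a diagonal inside \<open>X\<close>, go from
  \<open>x\<close> to \<open>y\<close> through \<open>p\<close>; if \<open>xy\<close> is one, go
  straight. Otherwise two of the four sight lines cross at some \<open>z\<close>, and the path bends
  there. Triangles with sides in \<open>X\<close> show that these paths stay in the
  intersection.\<close>

lemma connected_sees_Int:
  fixes X :: "complex set"
  assumes X: "compact X" "connected (- X)"
  shows "connected ({x. sees X x p} \<inter> {x. sees X x q})" (is "connected ?C")
proof -
  have "\<exists>T. connected T \<and> T \<subseteq> ?C \<and> x \<in> T \<and> y \<in> T" if xy: "x \<in> ?C" "y \<in> ?C" for x y
  proof -
    have seg: "closed_segment p x \<subseteq> X" "closed_segment q x \<subseteq> X" "closed_segment p y \<subseteq> X" "closed_segment q y \<subseteq> X"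
      using xy unfolding sees_def by (auto simp: closed_segment_commute)
    have via: "\<exists>T. connected T \<and> T \<subseteq> ?C \<and> x \<in> T \<and> y \<in> T"
      if "closed_segment x z \<subseteq> ?C" "closed_segment z y \<subseteq> ?C" for z
    proof (intro exI conjI)
      show "connected (closed_segment x z \<union> closed_segment z y)"
        by (rule connected_Un) auto
    qed (use that in auto)
    have hull: "closed_segment a b \<subseteq> convex hull {a, b, c}" "closed_segment b c \<subseteq> convex hull {a, b, c}"
      "a \<in> convex hull {a, b, c}" "c \<in> convex hull {a, b, c}" for a b c :: complex
      by (simp_all add: segment_convex_hull hull_mono hull_inc)
    \<comment> \<open>Both \<open>az\<close> and \<open>zc\<close> are parts of sight lines, so the
      triangle \<open>a\<close>, \<open>z\<close>, \<open>c\<close> has its sides in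
      \<open>X\<close>.\<close>
    have tri: "closed_segment a z \<subseteq> {v. sees X v c}"
      if "closed_segment a c \<subseteq> X" "closed_segment b a \<subseteq> X" "closed_segment c d \<subseteq> X" "z \<in> closed_segment b a" "z \<in> closed_segment c d" for a b c d z
    proof -
      have tri: "closed_segment a z \<subseteq> X" "closed_segment z c \<subseteq> X"
        using that by (meson ends_in_segment order_trans subset_closed_segment)+
      then show ?thesis
        using triangle_sees[OF X, of a z c] that hull[where a = a and b = z and c = c] by (auto simp: closed_segment_commute)
    qed
    \<comment> \<open>Moving along a sight line towards its end \<open>b\<close> keeps
      \<open>b\<close> visible.\<close>
    have own: "closed_segment a z \<subseteq> {v. sees X v b}" if "closed_segment b a \<subseteq> X" "z \<in> closed_segment b a" for a b z
    proof
      fix v assume "v \<in> closed_segment a z"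
      then have "v \<in> closed_segment b a"
        using that by (meson ends_in_segment subsetD subset_closed_segment)
      then have "closed_segment v b \<subseteq> X"
        using that(1) by (meson ends_in_segment order_trans subset_closed_segment)
      then show "v \<in> {v. sees X v b}"
        unfolding sees_def by auto
    qed
    show ?thesis
    proof (cases rule: four_points_cases[of p q x y])
      case 1
      then have pq: "closed_segment p q \<subseteq> X"
        using diagonal_subset[OF X seg] by blast
      have "closed_segment a p \<subseteq> ?C"
        if "closed_segment p a \<subseteq> X" "closed_segment q a \<subseteq> X" for a
        using triangle_sees[OF X, of a p q] that pq hull[where a = a and b = p and c = q]
        by (auto simp: closed_segment_commute hull_inc)
      from this[of x] this[of y] seg show ?thesis
        using via[of p] by (simp add: closed_segment_commute)
    next
      case 2
      then have xy': "closed_segment x y \<subseteq> X"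
        using diagonal_subset[OF X, of x p y q] seg by (simp add: closed_segment_commute)
      have "closed_segment x y \<subseteq> {v. sees X v a}"
        if "closed_segment a x \<subseteq> X" "closed_segment a y \<subseteq> X" for a
        using triangle_sees[OF X, of x y a] that xy' hull[where a = x and b = y and c = a] by (auto simp: closed_segment_commute)
      then show ?thesis
        using via[of y] seg xy by auto
    next
      case 3
      then obtain z where z: "z \<in> closed_segment p x" "z \<in> closed_segment q y"
        by blast
      show ?thesis
        using via[of z] tri[of x q p y z] tri[of y p q x z] own[where b = p and a = x and z = z] own[where b = q and a = y and z = z] seg z
        by (simp add: closed_segment_commute)
    next
      case 4
      then obtain z where z: "z \<in> closed_segment p y" "z \<in> closed_segment q x"
        by blast
      show ?thesis
        using via[of z] tri[of x p q y z] tri[of y q p x z] own[where b = q and a = x and z = z] own[where b = p and a = y and z = z] seg z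
        by (simp add: closed_segment_commute)
    qed
  qed
  then have "\<forall>x\<in>?C. \<forall>y\<in>?C. connected_component ?C x y"
    unfolding connected_component_def by (intro ballI)
  then show ?thesis
    by (rule connected_iff_connected_component[THEN iffD2])
qed

text \<open>Two points of \<open>L\<close> that see \<open>p\<close> span with it a triangle whose
  sides lie in \<open>X\<close>, hence the whole triangle does.\<close>

lemma convex_sees_Int:
  fixes X :: "complex set"
  assumes X: "compact X" "connected (- X)" and L: "convex L" "L \<subseteq> X"
  shows "convex ({x. sees X x p} \<inter> L)"
  unfolding convex_contains_segment
proof (intro ballI subsetI)
  fix x y v
  assume xy: "x \<in> {x. sees X x p} \<inter> L" "y \<in> {x. sees X x p} \<inter> L" and v: "v \<in> closed_segment x y"
  have "closed_segment x y \<subseteq> L"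
    using xy L(1) by (simp add: closed_segment_subset)
  moreover have "v \<in> convex hull {x, y, p}"
    using v by (metis hull_mono insert_commute segment_convex_hull subsetD subset_insertI)
  ultimately have "sees X v p"
    using triangle_sees[OF X, of x y p v p] xy L(2) unfolding sees_def by (auto simp: closed_segment_commute hull_inc)
  then show "v \<in> {x. sees X x p} \<inter> L"
    using v \<open>closed_segment x y \<subseteq> L\<close> by blast
qed

lemma compact_sees:
  fixes X :: "'a::euclidean_space set"
  assumes "compact X"
  shows "compact {x. sees X x p}"
proof (cases "p \<in> X")
  case True
  \<comment> \<open>For each fixed ratio \<open>t\<close> it is a closed condition that the point at
    \<open>t\<close> lies in \<open>X\<close>.\<close>
  have "{x. sees X x p} = X \<inter> (\<Inter>t\<in>{0..1}. (\<lambda>x. (1 - t) *\<^sub>R x + t *\<^sub>R p) -` X)"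
    using True unfolding sees_def closed_segment_def by fastforce
  moreover have "closed ((\<lambda>x. (1 - t) *\<^sub>R x + t *\<^sub>R p) -` X)" for t :: real
    using assms by (intro continuous_closed_vimage) (auto intro!: continuous_intros compact_imp_closed)
  then have "closed (\<Inter>t\<in>{0..1::real}. (\<lambda>x. (1 - t) *\<^sub>R x + t *\<^sub>R p) -` X)"
    by blast
  ultimately show ?thesis
    using assms by (simp add: compact_Int_closed)
qed (simp add: sees_def)

section \<open>Decomposition into a tree of convex pieces\<close>

lemma ex_connected_enumeration:
  fixes F :: "'a::topological_space set set"
  assumes "finite F" "\<And>P. P \<in> F \<Longrightarrow> closed P \<and> connected P \<and> P \<noteq> {}" "connected (\<Union>F)"
  obtains xs where "distinct xs" "set xs = F" "\<And>k. connected (\<Union>(set (take k xs)))"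
proof -
  have "\<exists>xs. distinct xs \<and> set xs \<subseteq> F \<and> length xs = m \<and> (\<forall>k. connected (\<Union>(set (take k xs))))"
    if "m \<le> card F" for m
    using that
  proof (induction m)
    case 0
    show ?case
      by (rule exI[of _ "[]"]) simp
  next
    case (Suc m)
    then obtain xs where xs: "distinct xs" "set xs \<subseteq> F" "length xs = m" "\<And>k. connected (\<Union>(set (take k xs)))"
      by auto
    have "set xs \<noteq> F"
      using xs Suc.prems distinct_card by fastforce
    \<comment> \<open>Members of \<open>F\<close> are nonempty, so the first alternative occurs only
      at the start of the list.\<close>
    obtain P where P: "P \<in> F - set xs" "\<Union>(set xs) = {} \<or> P \<inter> \<Union>(set xs) \<noteq> {}"
    proof (rule ccontr)
      assume "\<not> thesis"
      then have none: "\<Union>(set xs) \<noteq> {}" "P \<inter> \<Union>(set xs) = {}" if "P \<in> F - set xs" for P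
        using that \<open>\<And>P. \<lbrakk>P \<in> F - set xs; \<Union>(set xs) = {} \<or> P \<inter> \<Union>(set xs) \<noteq> {}\<rbrakk> \<Longrightarrow> thesis\<close> by blast+
      obtain P where P: "P \<in> F - set xs"
        using \<open>set xs \<noteq> F\<close> xs(2) by blast
      have "closed (\<Union>(set xs))" "closed (\<Union>(F - set xs))"
        using assms xs(2) by (auto intro!: closed_Union)
      moreover have "\<Union>(set xs) \<inter> \<Union>(F - set xs) = {}"
        using none(2) by blast
      moreover have "\<Union>F = \<Union>(set xs) \<union> \<Union>(F - set xs)"
        using xs(2) by blast
      ultimately have "\<Union>(set xs) = {} \<or> \<Union>(F - set xs) = {}"
        using connected_closedD[OF assms(3), of "\<Union>(set xs)" "\<Union>(F - set xs)"] by auto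
      then show False
        using none(1)[OF P] P assms(2) by blast
    qed
    have "connected (P \<union> \<Union>(set xs))"
    proof (cases "\<Union>(set xs) = {}")
      case True
      then show ?thesis
        unfolding True using P assms(2) by simp
    next
      case False
      then show ?thesis
        using P xs(4)[of m] xs(3) assms(2)[of P] by (intro connected_Un) auto
    qed
    then have "connected (\<Union>(set (take k (xs @ [P]))))" for k
      using xs(3) xs(4)[of k] by (cases "k \<le> m") (simp_all add: Un_commute)
    then show ?case
      using P xs by (intro exI[of _ "xs @ [P]"]) auto
  qed
  from this[of "card F"] obtain xs where xs: "distinct xs" "set xs \<subseteq> F" "length xs = card F"
      "\<And>k. connected (\<Union>(set (take k xs)))"
    by auto
  then have "set xs = F"
    using assms(1) by (metis card_subset_eq distinct_card)
  then show thesis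
    using that xs by blast
qed

text \<open>On \<open>T\<close> use the nearest-point map to the convex set
  \<open>S \<inter> T\<close>; it agrees with the identity of \<open>S\<close> on the
  overlap.\<close>

lemma retract_of_Un_convex_Int:
  fixes S T :: "'a::euclidean_space set"
  assumes "closed S" "closed T" "convex (S \<inter> T)" "S \<inter> T \<noteq> {}"
  shows "S retract_of (S \<union> T)"
proof -
  define r where "r x = (if x \<in> S then x else closest_point (S \<inter> T) x)" for x
  have "continuous_on (S \<union> T) r"
    unfolding r_def
  proof (rule continuous_on_cases)
    show "continuous_on T (closest_point (S \<inter> T))"
      using assms by (intro continuous_on_closest_point) (auto intro: closed_Int)
    show "\<forall>x. x \<in> S \<and> x \<notin> S \<or> x \<in> T \<and> x \<in> S \<longrightarrow> x = closest_point (S \<inter> T) x"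
      by (simp add: closest_point_self)
  qed (use assms in \<open>auto intro: continuous_on_id\<close>)
  moreover have "r x \<in> S" if "x \<in> S \<union> T" for x
    using that closest_point_in_set[of "S \<inter> T" x] assms unfolding r_def by (auto intro: closed_Int)
  moreover have "r x = x" if "x \<in> S" for x
    using that unfolding r_def by simp
  ultimately show ?thesis
    unfolding retract_of_def retraction_def by (intro exI[of _ r]) auto
qed

text \<open>A compact planar set with connected complement is Borsukian, hence unicoherent.
  Unicoherence makes the last gate connected, and \<open>gate\<close> upgrades this to convex. The
  union without the last piece is then a retract, so it is Borsukian again and the argument repeats
  downwards.\<close>

lemma ex_tree_of_convex_sets:
  fixes F :: "complex set set"
  assumes "finite F" and F: "\<And>P. P \<in> F \<Longrightarrow> compact P \<and> convex P \<and> P \<noteq> {}"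
    and "connected (\<Union>F)" "connected (- \<Union>F)"
    and gate: "\<And>P G. P \<in> F \<Longrightarrow> G \<subseteq> F - {P} \<Longrightarrow> connected (P \<inter> \<Union>G) \<Longrightarrow> convex (P \<inter> \<Union>G)"
  obtains L N where "tree_of_convex_sets L N" "(\<Union>k<N. L k) = \<Union>F" "\<And>k. k < N \<Longrightarrow> L k \<in> F"
proof -
  obtain xs where xs: "distinct xs" "set xs = F" "\<And>k. connected (\<Union>(set (take k xs)))"
    using ex_connected_enumeration[of F] assms(1-3) by (metis compact_imp_closed convex_connected)
  define N where "N = length xs"
  define L where "L k = xs ! k" for k
  have LF: "L k \<in> F" if "k < N" for k
    using that xs(2) unfolding L_def N_def by auto
  have K: "(\<Union>j<k. L j) = \<Union>(set (take k xs))" if "k \<le> N" for k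
    using nth_image[of k xs] that unfolding L_def N_def by (simp add: atLeast0LessThan)
  have Kconn: "connected (\<Union>j<k. L j)" if "k \<le> N" for k
    using K[OF that] xs(3) by simp
  have Kclosed: "closed (\<Union>j<k. L j)" if "k \<le> N" for k
    using LF F that by (intro closed_UN) (auto intro: compact_imp_closed)
  have KF: "(\<Union>k<N. L k) = \<Union>F"
    using K[of N] xs(2) unfolding N_def by simp
  have KSuc: "(\<Union>j<Suc k. L j) = (\<Union>j<k. L j) \<union> L k" for k
    by (auto simp: less_Suc_eq)
  have step: "convex (L k \<inter> (\<Union>j<k. L j))" if "k < N" "Borsukian (\<Union>j<Suc k. L j)" for k
  proof -
    have "connected (L k \<inter> (\<Union>j<k. L j))"
    proof (rule unicoherentD[OF Borsukian_imp_unicoherent[OF that(2)]])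
      show "connected (L k)"
        using LF F that(1) by (simp add: convex_connected)
      show "connected (\<Union>j<k. L j)"
        using Kconn that(1) by simp
      show "(\<Union>j<Suc k. L j) = L k \<union> (\<Union>j<k. L j)"
        using KSuc by blast
      show "closedin (top_of_set (\<Union>j<Suc k. L j)) (L k)"
        using LF F that(1) by (intro closed_subset) (auto intro: compact_imp_closed)
      show "closedin (top_of_set (\<Union>j<Suc k. L j)) (\<Union>j<k. L j)"
        using Kclosed that(1) KSuc by (intro closed_subset) auto
    qed
    moreover have "set (take k xs) \<subseteq> F - {L k}"
    proof -
      have "L k \<notin> set (take k xs)"
        using xs(1) that(1) unfolding L_def N_def
        by (auto simp: in_set_conv_nth nth_eq_iff_index_eq)
      then show ?thesis
        using xs(2) set_take_subset[of k xs] by blast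
    qed
    ultimately show ?thesis
      using gate[OF LF[OF that(1)]] K that(1) by simp
  qed
  have Bors: "Borsukian (\<Union>j<N - d. L j)" if "d < N" for d
    using that
  proof (induction d)
    case 0
    have "compact (\<Union>F)"
      using assms(1) F by (simp add: compact_Union)
    then show ?case
      using assms(4) KF by (simp add: Borsukian_separation_compact)
  next
    case (Suc d)
    define k where "k = N - Suc d"
    have k: "N - d = Suc k" "k < N" "0 < k"
      using Suc.prems unfolding k_def by auto
    have Bk: "Borsukian (\<Union>j<Suc k. L j)"
      using Suc k by simp
    have clL: "closed (L k)"
      using LF[OF k(2)] F by (simp add: compact_imp_closed)
    \<comment> \<open>The retraction needs a nonempty gate; two disjoint nonempty closed sets would
      disconnect the initial union.\<close>
    have "(\<Union>j<k. L j) \<inter> L k \<noteq> {}"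
    proof -
      have "L k \<noteq> {}" "L 0 \<noteq> {}"
        using LF[of k] LF[of 0] F k by auto
      then have "(\<Union>j<k. L j) \<noteq> {}"
        using k(3) by blast
      moreover have "connected ((\<Union>j<k. L j) \<union> L k)"
        using Kconn[of "Suc k"] k(2) unfolding KSuc by simp
      moreover have "closed (\<Union>j<k. L j)"
        using Kclosed k(2) by simp
      ultimately show ?thesis
        using connected_closedD[of "(\<Union>j<k. L j) \<union> L k" "\<Union>j<k. L j" "L k"] clL \<open>L k \<noteq> {}\<close> by blast
    qed
    then have "(\<Union>j<k. L j) retract_of ((\<Union>j<k. L j) \<union> L k)"
      using step[OF k(2) Bk] Kclosed[of k] clL k(2) by (intro retract_of_Un_convex_Int) (simp_all add: Int_commute)
    then show ?case
      using retract_of_Borsukian Bk KSuc[of k] k_def by metis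
  qed
  have "convex (L k \<inter> (\<Union>j<k. L j))" if "k < N" for k
    using step[OF that] Bors[of "N - Suc k"] that by simp
  then have "tree_of_convex_sets L N"
    unfolding tree_of_convex_sets_def using LF F by blast
  then show thesis
    using that KF LF by blast
qed

lemma colorful_Helly_visibility:
  fixes F :: "complex set set" and P :: "nat \<Rightarrow> complex set"
  assumes "finite F" and F: "\<And>P. P \<in> F \<Longrightarrow> compact P \<and> convex P \<and> P \<noteq> {}"
    and conn: "connected (\<Union>F)" "connected (- \<Union>F)"
    and gate: "\<And>P G. P \<in> F \<Longrightarrow> G \<subseteq> F - {P} \<Longrightarrow> connected (P \<inter> \<Union>G) \<Longrightarrow> convex (P \<inter> \<Union>G)"
    and P: "\<And>i. i \<in> {1, 2, 3} \<Longrightarrow> finite (P i) \<and> P i \<noteq> {}"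
    and ne: "\<And>p1 p2 p3. p1 \<in> P 1 \<Longrightarrow> p2 \<in> P 2 \<Longrightarrow> p3 \<in> P 3 \<Longrightarrow>
           \<exists>x. sees (\<Union>F) x p1 \<and> sees (\<Union>F) x p2 \<and> sees (\<Union>F) x p3"
  shows "\<exists>i\<in>{1, 2, 3}. \<exists>x. \<forall>p\<in>P i. sees (\<Union>F) x p"
proof -
  obtain L N where L: "tree_of_convex_sets L N" "(\<Union>k<N. L k) = \<Union>F" "\<And>k. k < N \<Longrightarrow> L k \<in> F"
    using ex_tree_of_convex_sets[OF assms(1) F conn gate] by blast
  have X: "compact (\<Union>F)"
    using assms(1) F by (simp add: compact_Union)
  have "\<exists>i\<in>{1, 2, 3}. \<exists>x. \<forall>p\<in>P i. x \<in> {x. sees (\<Union>F) x p}"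
  proof (rule colorful_Helly_tree_of_convex_sets[OF _ L(1) _ _ _ P])
    show "compact ({x. sees (\<Union>F) x p} \<inter> L k) \<and> convex ({x. sees (\<Union>F) x p} \<inter> L k)" if "k < N" for p k
    proof -
      have "compact (L k)" "convex (L k)" "L k \<subseteq> \<Union>F"
        using L(3)[OF that] F by auto
      then show ?thesis
        using compact_Int[OF compact_sees[OF X]] convex_sees_Int[OF X conn(2)] by blast
    qed
    show "{x. sees (\<Union>F) x p} \<subseteq> (\<Union>k<N. L k)" for p
      unfolding L(2) sees_def by blast
    show "connected ({x. sees (\<Union>F) x p} \<inter> {x. sees (\<Union>F) x q})" for p q
      by (rule connected_sees_Int[OF X conn(2)])
    show "{x. sees (\<Union>F) x p} \<inter> {x. sees (\<Union>F) x q} \<inter> {x. sees (\<Union>F) x r} \<noteq> {}"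
      if "p \<in> P 1" "q \<in> P 2" "r \<in> P 3" for p q r
      using ne[OF that] by blast
  qed simp
  then show ?thesis
    by simp
qed

section \<open>Grid cells and their rows\<close>

definition cell :: "real \<Rightarrow> int \<Rightarrow> int \<Rightarrow> complex set" where
  "cell h i j = cbox (Complex (h * i) (h * j)) (Complex (h * (i + 1)) (h * (j + 1)))"

lemma in_cell:
  "z \<in> cell h i j \<longleftrightarrow> h * i \<le> Re z \<and> Re z \<le> h * (i + 1) \<and> h * j \<le> Im z \<and> Im z \<le> h * (j + 1)"
  unfolding cell_def in_cbox_complex_iff by auto

lemma compact_cell: "compact (cell h i j)" and convex_cell: "convex (cell h i j)"
  unfolding cell_def by (simp_all add: compact_cbox)

lemma corner_in_cell: "0 < h \<Longrightarrow> Complex (h * i) (h * j) \<in> cell h i j"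
  by (simp add: in_cell)

text \<open>The components of a row are the maximal horizontal rectangles that serve as convex
  pieces.\<close>

definition cell_row :: "real \<Rightarrow> (int \<times> int) set \<Rightarrow> int \<Rightarrow> complex set" where
  "cell_row h S j = (\<Union>i\<in>{i. (i, j) \<in> S}. cell h i j)"

text \<open>The real parts of \<open>C\<close> form an interval contained in \<open>I\<close>, so a
  segment between points of \<open>C\<close> stays in the strip and, by maximality, in the
  component.\<close>

lemma convex_component_of_strip:
  assumes "C \<in> components {z. Re z \<in> I \<and> a \<le> Im z \<and> Im z \<le> b}"
  shows "convex C"
  unfolding convex_contains_segment
proof (intro ballI)
  fix x y assume xy: "x \<in> C" "y \<in> C"
  let ?R = "{z. Re z \<in> I \<and> a \<le> Im z \<and> Im z \<le> b}"
  have CR: "C \<subseteq> ?R"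
    using in_components_subset[OF assms] .
  have "connected (Re ` C)"
    using in_components_connected[OF assms] by (intro connected_continuous_image continuous_intros)
  then have "convex (Re ` C)"
    by (simp add: connected_convex_1)
  then have "closed_segment (Re x) (Re y) \<subseteq> Re ` C"
    using xy by (intro closed_segment_subset) auto
  moreover have "Re z \<in> closed_segment (Re x) (Re y)" "a \<le> Im z" "Im z \<le> b" if z: "z \<in> closed_segment x y" for z
  proof -
    obtain u where u: "0 \<le> u" "u \<le> 1" "z = (1 - u) *\<^sub>R x + u *\<^sub>R y"
      using z unfolding in_segment by blast
    then show "Re z \<in> closed_segment (Re x) (Re y)"
      unfolding in_segment by auto
    have "Im z \<in> closed_segment (Im x) (Im y)"
      using u unfolding in_segment by auto
    moreover have "Im x \<in> {a..b}" "Im y \<in> {a..b}"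
      using CR xy by auto
    then have "closed_segment (Im x) (Im y) \<subseteq> {a..b}"
      by (intro closed_segment_subset) (auto simp: convex_real_interval)
    ultimately show "a \<le> Im z" "Im z \<le> b"
      by auto
  qed
  moreover have "Re ` C \<subseteq> I"
    using CR by auto
  ultimately have "closed_segment x y \<subseteq> ?R"
    by blast
  then show "closed_segment x y \<subseteq> C"
    using xy by (intro components_maximal[OF assms]) auto
qed

lemma convex_if_connected_horizontal:
  assumes "connected S" "\<And>z. z \<in> S \<Longrightarrow> Im z = c"
  shows "convex S"
  unfolding convex_contains_segment
proof (intro ballI subsetI)
  fix x y z assume xy: "x \<in> S" "y \<in> S" and z: "z \<in> closed_segment x y"
  then obtain u where u: "0 \<le> u" "u \<le> 1" "z = (1 - u) *\<^sub>R x + u *\<^sub>R y"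
    unfolding in_segment by blast
  have "convex (Re ` S)"
    unfolding connected_convex_1[symmetric] using assms(1) by (intro connected_continuous_image continuous_intros)
  then have "closed_segment (Re x) (Re y) \<subseteq> Re ` S"
    using xy by (intro closed_segment_subset) auto
  moreover have "Re z \<in> closed_segment (Re x) (Re y)"
    using u unfolding in_segment by auto
  ultimately obtain w where w: "w \<in> S" "Re w = Re z"
    by auto
  have "Im z = c"
    using assms(2)[OF xy(1)] assms(2)[OF xy(2)] unfolding u(3) by (simp add: algebra_simps)
  then have "w = z"
    using w assms(2) by (simp add: complex_eq_iff)
  then show "z \<in> S"
    using w by simp
qed

text \<open>Applied to gates, which lie on the lower and upper edge of a rectangle: connectedness
  confines the set to one of the two lines.\<close>

lemma convex_if_connected_in_two_lines:
  assumes "connected S" "\<And>z. z \<in> S \<Longrightarrow> Im z = a \<or> Im z = b"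
  shows "convex S"
proof (cases "a = b")
  case True
  then show ?thesis
    using convex_if_connected_horizontal[OF assms(1)] assms(2) by blast
next
  case False
  have cl: "closed {z. Im z = c}" for c
    by (intro closed_Collect_eq continuous_intros)
  have "{z. Im z = a} \<inter> S = {} \<or> {z. Im z = b} \<inter> S = {}"
    by (rule connected_closedD[OF assms(1) _ _ cl cl]) (use False assms(2) in auto)
  then have "\<exists>c. \<forall>z\<in>S. Im z = c"
    using assms(2) by blast
  then show ?thesis
    using convex_if_connected_horizontal[OF assms(1)] by blast
qed

lemma cell_row_eq:
  "cell_row h S j = {z. Re z \<in> (\<Union>i\<in>{i. (i, j) \<in> S}. {h * i..h * (i + 1)}) \<and> h * j \<le> Im z \<and> Im z \<le> h * (j + 1)}"
  unfolding cell_row_def by (auto simp: in_cell)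

text \<open>Every component contains a whole cell, so it is the component of that cell's
  corner.\<close>

lemma finite_components_cell_row:
  assumes "finite S" "0 < h"
  shows "finite (components (cell_row h S j))"
proof (rule finite_subset)
  let ?I = "{i. (i, j) \<in> S}"
  show "components (cell_row h S j) \<subseteq> (\<lambda>i. connected_component_set (cell_row h S j) (Complex (h * i) (h * j))) ` ?I"
  proof
    fix C assume C: "C \<in> components (cell_row h S j)"
    then obtain z where z: "z \<in> C"
      using in_components_nonempty by blast
    then obtain i where i: "i \<in> ?I" "z \<in> cell h i j"
      using in_components_subset[OF C] unfolding cell_row_def by blast
    have "cell h i j \<subseteq> C"
      using z i convex_cell by (intro components_maximal[OF C]) (auto simp: cell_row_def convex_connected)
    then have "Complex (h * i) (h * j) \<in> C"
      using corner_in_cell[OF assms(2)] by blast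
    moreover obtain x where "C = connected_component_set (cell_row h S j) x"
      using C unfolding components_def by blast
    ultimately have "C = connected_component_set (cell_row h S j) (Complex (h * i) (h * j))"
      using connected_component_eq by metis
    then show "C \<in> (\<lambda>i. connected_component_set (cell_row h S j) (Complex (h * i) (h * j))) ` ?I"
      using i(1) by blast
  qed
  have "?I \<subseteq> fst ` S"
    by force
  then show "finite ((\<lambda>i. connected_component_set (cell_row h S j) (Complex (h * i) (h * j))) ` ?I)"
    using assms(1) finite_subset by blast
qed

text \<open>Distinct components of one row are disjoint, so a rectangle meets the others only in
  adjacent rows, along its lower or upper edge. This gives the gate condition for the family
  \<open>F\<close> of all row components.\<close>

lemma colorful_Helly_grid:
  fixes P :: "nat \<Rightarrow> complex set"
  assumes S: "finite S" "0 < h" and X: "X = (\<Union>(i, j)\<in>S. cell h i j)"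
    and conn: "connected X" "connected (- X)"
    and P: "\<And>i. i \<in> {1, 2, 3} \<Longrightarrow> finite (P i) \<and> P i \<noteq> {}"
    and ne: "\<And>p1 p2 p3. p1 \<in> P 1 \<Longrightarrow> p2 \<in> P 2 \<Longrightarrow> p3 \<in> P 3 \<Longrightarrow>
           \<exists>x. sees X x p1 \<and> sees X x p2 \<and> sees X x p3"
  shows "\<exists>i\<in>{1, 2, 3}. \<exists>x. \<forall>p\<in>P i. sees X x p"
proof -
  define F where "F = (\<Union>j\<in>snd ` S. components (cell_row h S j))"
  have UF: "\<Union>F = X"
  proof -
    have "\<Union>F = (\<Union>j\<in>snd ` S. \<Union>(components (cell_row h S j)))"
      unfolding F_def by blast
    also have "\<dots> = (\<Union>j\<in>snd ` S. cell_row h S j)"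
      by simp
    also have "\<dots> = X"
      unfolding X cell_row_def by force
    finally show ?thesis .
  qed
  have comp_row: "compact (cell_row h S j)" for j
  proof -
    have "{i. (i, j) \<in> S} \<subseteq> fst ` S"
      by force
    then have "finite {i. (i, j) \<in> S}"
      using S(1) finite_subset by blast
    then show ?thesis
      unfolding cell_row_def by (intro compact_UN compact_cell)
  qed
  have F: "compact C \<and> convex C \<and> C \<noteq> {}" if CF: "C \<in> F" for C
  proof -
    obtain j where C: "C \<in> components (cell_row h S j)"
      using CF unfolding F_def by blast
    show ?thesis
      using compact_components[OF comp_row C] convex_component_of_strip[OF C[unfolded cell_row_eq]]
        in_components_nonempty[OF C] by blast
  qed
  have gate: "convex (C \<inter> \<Union>G)" if C: "C \<in> F" and G: "G \<subseteq> F - {C}" and "connected (C \<inter> \<Union>G)" for C G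
  proof -
    obtain j where j: "C \<in> components (cell_row h S j)"
      using C unfolding F_def by blast
    have "Im z = h * j \<or> Im z = h * (j + 1)" if z: "z \<in> C \<inter> \<Union>G" for z
    proof -
      obtain D where D: "D \<in> G" "z \<in> D"
        using z by blast
      then obtain j' where j': "D \<in> components (cell_row h S j')"
        using G unfolding F_def by blast
      have "D \<noteq> C"
        using D G by blast
      then have "j' \<noteq> j"
        using components_nonoverlap[OF j, of D] j' z D by blast
      have bounds: "h * j \<le> Im z" "Im z \<le> h * (j + 1)" "h * j' \<le> Im z" "Im z \<le> h * (j' + 1)"
        using in_components_subset[OF j] in_components_subset[OF j'] z D unfolding cell_row_eq by auto
      then have "h * j \<le> h * of_int (j' + 1)" "h * j' \<le> h * of_int (j + 1)"
        by simp_all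
      then have "j \<le> j' + 1" "j' \<le> j + 1"
        using S(2) by (simp_all only: mult_le_cancel_left_pos of_int_le_iff)
      then consider "j' = j + 1" | "j = j' + 1"
        using \<open>j' \<noteq> j\<close> by linarith
      then show ?thesis
        using bounds by cases simp_all
    qed
    then show ?thesis
      using convex_if_connected_in_two_lines[OF that(3)] by blast
  qed
  have "finite F"
    unfolding F_def using S finite_components_cell_row by auto
  show ?thesis
    unfolding UF[symmetric]
    by (rule colorful_Helly_visibility[OF \<open>finite F\<close> F _ _ gate P]) (use conn ne UF in simp_all)
qed

section \<open>Filling the holes of a planar continuum\<close>

text \<open>Local path-connectedness of \<open>G\<close> is what makes the lift of \<open>\<lambda>y. y - z\<close> through \<open>exp\<close> continuous.\<close>

lemma outside_if_simply_connected:
  fixes G K :: "complex set"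
  assumes K: "simply_connected K" and G: "compact G" "connected G" "locally path_connected G" "G \<subseteq> K"
    and "z \<notin> K"
  shows "z \<in> outside G"
proof (cases "G = {}")
  case True
  then show ?thesis
    by (simp add: outside_def not_bounded_UNIV)
next
  case False
  then obtain a where a: "a \<in> G"
    by blast
  have z: "z \<notin> G"
    using assms by blast
  have pG: "path_connected G"
    using G(2) path_component_eq_connected_component[OF G(3)]
    by (simp add: path_connected_component connected_iff_connected_component)
  have exp_a: "exp (Ln (a - z)) = a - z"
    using a z by (intro exp_Ln) auto
  obtain g where g: "continuous_on G g" "\<And>y. y \<in> G \<Longrightarrow> exp (g y) = y - z"
  proof (rule covering_space_lift_general[OF covering_space_exp_punctured_plane UNIV_I a pG G(3), of "\<lambda>y. y - z" "Ln (a - z)"])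
    show "continuous_on G (\<lambda>y. y - z)"
      by (intro continuous_intros)
    show "(\<lambda>y. y - z) \<in> G \<rightarrow> - {0}"
      using z by auto
    show "a - z = exp (Ln (a - z))"
      using exp_a by simp
    \<comment> \<open>The lifting criterion asks only that loops of \<open>G\<close> become trivial
      in the punctured plane. The loop \<open>r\<close> contracts in \<open>K\<close>, and
      translation by the missing point \<open>z\<close> carries the contraction into
      \<open>- {0}\<close>.\<close>
    fix r assume r: "path r" "path_image r \<subseteq> G" "pathstart r = a" "pathfinish r = a"
    have "homotopic_paths K r (linepath a a)"
      using K r a G(4) simply_connected_imp_path_connected unfolding simply_connected_eq_contractible_path by auto
    moreover have "continuous_on K (\<lambda>y. y - z)" "(\<lambda>y. y - z) \<in> K \<rightarrow> - {0}"
      using \<open>z \<notin> K\<close> by (auto intro!: continuous_intros)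
    ultimately have "homotopic_paths (- {0}) ((\<lambda>y. y - z) \<circ> r) ((\<lambda>y. y - z) \<circ> linepath a a)"
      using homotopic_paths_continuous_image by blast
    moreover have "(\<lambda>y. y - z) \<circ> linepath a a = exp \<circ> linepath (Ln (a - z)) (Ln (a - z))"
      using exp_a by (simp add: linepath_def fun_eq_iff algebra_simps flip: scaleR_left.add)
    ultimately show "\<exists>q. path q \<and> path_image q \<subseteq> UNIV \<and> pathstart q = Ln (a - z) \<and> pathfinish q = Ln (a - z) \<and>
        homotopic_paths (- {0}) ((\<lambda>y. y - z) \<circ> r) (exp \<circ> q)"
      by (intro exI[of _ "linepath (Ln (a - z)) (Ln (a - z))"]) simp
  qed auto
  \<comment> \<open>The logarithm \<open>g\<close> shows that the radial map from \<open>z\<close>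
    to the circle is inessential. By Borsuk's criterion it would be essential if \<open>z\<close>
    lay in a bounded component of \<open>- G\<close>.\<close>
  have "\<exists>c. homotopic_with_canon (\<lambda>x. True) G (sphere 0 1) (\<lambda>y. inverse (norm (y - z)) *\<^sub>R (y - z)) (\<lambda>x. c)"
    unfolding inessential_eq_continuous_logarithm_circle
  proof (intro exI conjI ballI)
    show "continuous_on G (\<lambda>y. Im (g y))"
      using g(1) by (intro continuous_intros)
    fix y assume "y \<in> G"
    have "norm (y - z) = exp (Re (g y))"
      using g(2)[OF \<open>y \<in> G\<close>] by (metis norm_exp_eq_Re)
    then have "inverse (norm (y - z)) *\<^sub>R (y - z) = of_real (exp (- Re (g y))) * exp (g y)"
      using g(2)[OF \<open>y \<in> G\<close>] by (simp add: scaleR_conv_of_real exp_minus of_real_exp flip: exp_of_real)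
    also have "\<dots> = exp (\<i> * of_real (Im (g y)))"
    proof -
      have "of_real (- Re (g y)) + g y = \<i> * of_real (Im (g y))"
        by (simp add: complex_eq_iff)
      then show ?thesis
        by (metis exp_add exp_of_real)
    qed
    finally show "inverse (norm (y - z)) *\<^sub>R (y - z) = exp (\<i> * of_real (Im (g y)))" .
  qed
  then have "\<not> bounded (connected_component_set (- G) z)"
    using Borsuk_map_essential_bounded_component[OF G(1) z] by blast
  then show ?thesis
    unfolding outside by simp
qed

section \<open>Grid neighbourhoods and their filled versions\<close>

definition grid_nbhd :: "real \<Rightarrow> complex set \<Rightarrow> complex set" where
  "grid_nbhd h A = (\<Union>(i, j)\<in>{(i, j). cell h i j \<inter> A \<noteq> {}}. cell h i j)"

lemma in_floor_cell:
  assumes "0 < h"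
  shows "z \<in> cell h \<lfloor>Re z / h\<rfloor> \<lfloor>Im z / h\<rfloor>"
proof -
  have "h * \<lfloor>x / h\<rfloor> \<le> x \<and> x \<le> h * (\<lfloor>x / h\<rfloor> + 1)" for x
  proof -
    have "of_int \<lfloor>x / h\<rfloor> \<le> x / h" "x / h \<le> of_int \<lfloor>x / h\<rfloor> + 1"
      by linarith+
    then have "h * \<lfloor>x / h\<rfloor> \<le> h * (x / h)" "h * (x / h) \<le> h * (\<lfloor>x / h\<rfloor> + 1)"
      using assms by (simp_all only: mult_le_cancel_left_pos)
    then show ?thesis
      using assms by simp
  qed
  then show ?thesis
    by (simp add: in_cell)
qed

lemma subset_grid_nbhd: "0 < h \<Longrightarrow> A \<subseteq> grid_nbhd h A"
  unfolding grid_nbhd_def using in_floor_cell by fast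

lemma dist_cell_le:
  assumes "z \<in> cell h i j" "w \<in> cell h i j"
  shows "dist z w \<le> 2 * h"
proof -
  have "\<bar>Re (z - w)\<bar> \<le> h" "\<bar>Im (z - w)\<bar> \<le> h"
    using assms unfolding in_cell by (auto simp: algebra_simps)
  then show ?thesis
    using cmod_le[of "z - w"] by (simp add: dist_norm)
qed

lemma grid_nbhd_dist:
  assumes "z \<in> grid_nbhd h A"
  obtains a where "a \<in> A" "dist z a \<le> 2 * h"
  using assms dist_cell_le unfolding grid_nbhd_def by blast

lemma finite_cells_meeting:
  assumes "0 < h" "bounded A"
  shows "finite {(i, j). cell h i j \<inter> A \<noteq> {}}"
proof -
  obtain R where R: "\<And>z. z \<in> A \<Longrightarrow> norm z \<le> R"
    using assms(2) unfolding bounded_iff by blast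
  \<comment> \<open>The lower end is shifted by one because the cell of index \<open>i\<close>
    reaches up to \<open>h * (i + 1)\<close>.\<close>
  have bound: "i \<in> {- \<lceil>R / h\<rceil> - 1..\<lceil>R / h\<rceil>}"
    if "h * i \<le> x" "x \<le> h * (i + 1)" "\<bar>x\<bar> \<le> R" for i :: int and x
  proof -
    have "real_of_int i * h \<le> R" "- (real_of_int i + 1) * h \<le> R"
      using that by (simp_all add: algebra_simps)
    then have "real_of_int i \<le> R / h" "- (real_of_int i + 1) \<le> R / h"
      using assms(1) by (simp_all only: pos_le_divide_eq)
    then show ?thesis
      unfolding atLeastAtMost_iff by linarith
  qed
  have "{(i, j). cell h i j \<inter> A \<noteq> {}} \<subseteq> {- \<lceil>R / h\<rceil> - 1..\<lceil>R / h\<rceil>} \<times> {- \<lceil>R / h\<rceil> - 1..\<lceil>R / h\<rceil>}"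
  proof clarify
    fix i j assume "cell h i j \<inter> A \<noteq> {}"
    then obtain z where z: "z \<in> cell h i j" "z \<in> A"
      by blast
    then have "\<bar>Re z\<bar> \<le> R" "\<bar>Im z\<bar> \<le> R"
      using R abs_Re_le_cmod abs_Im_le_cmod order_trans by blast+
    then show "i \<in> {- \<lceil>R / h\<rceil> - 1..\<lceil>R / h\<rceil>} \<and> j \<in> {- \<lceil>R / h\<rceil> - 1..\<lceil>R / h\<rceil>}"
      using z(1) bound[of i "Re z"] bound[of j "Im z"] unfolding in_cell by blast
  qed
  then show ?thesis
    by (rule finite_subset) simp
qed

lemma compact_grid_nbhd:
  assumes "0 < h" "bounded A"
  shows "compact (grid_nbhd h A)"
  unfolding grid_nbhd_def using finite_cells_meeting[OF assms] compact_cell by (intro compact_UN) auto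

lemma connected_grid_nbhd:
  assumes "0 < h" "connected A" "A \<noteq> {}"
  shows "connected (grid_nbhd h A)"
proof -
  let ?S = "{(i, j). cell h i j \<inter> A \<noteq> {}}"
  obtain a where a: "a \<in> A"
    using assms(3) by blast
  \<comment> \<open>Adjoining \<open>A\<close> to each cell that meets it gives connected sets with
    \<open>A\<close> in common.\<close>
  have "connected (\<Union>(i, j)\<in>?S. A \<union> cell h i j)"
  proof (rule connected_Union)
    show "connected C" if CS: "C \<in> (\<lambda>(i, j). A \<union> cell h i j) ` ?S" for C
    proof -
      obtain i j where "cell h i j \<inter> A \<noteq> {}" "C = A \<union> cell h i j"
        using CS by blast
      then show ?thesis
        using connected_Un[OF assms(2) convex_connected[OF convex_cell]] by (simp add: Int_commute)
    qed
    show "\<Inter> ((\<lambda>(i, j). A \<union> cell h i j) ` ?S) \<noteq> {}"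
      using a by blast
  qed
  also have "(\<Union>(i, j)\<in>?S. A \<union> cell h i j) = grid_nbhd h A"
    using subset_grid_nbhd[OF assms(1), of A] in_floor_cell[OF assms(1), of a] a unfolding grid_nbhd_def by blast
  finally show ?thesis .
qed

text \<open>Halving the side subdivides the grid; \<open>div\<close> rounds down for negative
  indices too, so it names the enclosing cell.\<close>

lemma cell_half_subset: "0 < h \<Longrightarrow> cell (h / 2) i j \<subseteq> cell h (i div 2) (j div 2)"
proof -
  assume h: "0 < h"
  have *: "h * (k div 2) \<le> h / 2 * k" "h / 2 * (k + 1) \<le> h * (k div 2 + 1)" for k :: int
  proof -
    have "2 * (k div 2) \<le> k" "k + 1 \<le> 2 * (k div 2) + 2"
      by linarith+
    then have "2 * real_of_int (k div 2) \<le> k" "real_of_int k + 1 \<le> 2 * real_of_int (k div 2) + 2"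
      by linarith+
    then have "h * (2 * real_of_int (k div 2)) \<le> h * k" "h * (real_of_int k + 1) \<le> h * (2 * real_of_int (k div 2) + 2)"
      using h by (simp_all only: mult_le_cancel_left_pos)
    then show "h * (k div 2) \<le> h / 2 * k" "h / 2 * (k + 1) \<le> h * (k div 2 + 1)"
      by (simp_all add: algebra_simps)
  qed
  show ?thesis
    using *[of i] *[of j] by (auto simp: in_cell)
qed

lemma grid_nbhd_half_subset:
  assumes "0 < h"
  shows "grid_nbhd (h / 2) A \<subseteq> grid_nbhd h A"
  unfolding grid_nbhd_def using cell_half_subset[OF assms] by fast

lemma in_interior_cell:
  "z \<in> interior (cell h i j) \<longleftrightarrow> h * i < Re z \<and> Re z < h * (i + 1) \<and> h * j < Im z \<and> Im z < h * (j + 1)"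
  unfolding cell_def interior_cbox in_box_complex_iff by auto

lemma interior_cell_Int_cell:
  assumes "0 < h" "interior (cell h i j) \<inter> cell h i' j' \<noteq> {}"
  shows "i' = i \<and> j' = j"
proof -
  obtain z where z: "z \<in> interior (cell h i j)" "z \<in> cell h i' j'"
    using assms(2) by blast
  have "k' = k" if "h * k < x" "x < h * (k + 1)" "h * k' \<le> x" "x \<le> h * (k' + 1)" for k k' :: int and x
  proof -
    have "h * k < h * of_int (k' + 1)" "h * k' < h * of_int (k + 1)"
      using that by simp_all
    then have "k < k' + 1" "k' < k + 1"
      using assms(1) by (simp_all only: mult_less_cancel_left_pos of_int_less_iff)
    then show ?thesis
      by linarith
  qed
  then show ?thesis
    using z unfolding in_cell in_interior_cell by blast
qed

text \<open>Filling the holes again gives a union of cells. If a cell contains a point of a hole,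
  its interior is connected and misses the neighbourhood, so it cannot meet both the inside and the
  outside. Both are open and the cell is the closure of its interior, so the cell avoids the
  outside.\<close>

lemma Compl_outside_grid_nbhd_eq_cells:
  assumes h: "0 < h" and A: "bounded A"
  shows "- outside (grid_nbhd h A)
    = (\<Union>(i, j)\<in>{(i, j). cell h i j \<subseteq> - outside (grid_nbhd h A)}. cell h i j)" (is "?X = ?U")
proof
  show "?U \<subseteq> ?X"
    by blast
  let ?F = "grid_nbhd h A"
  have F: "closed ?F"
    using compact_grid_nbhd[OF h A] by (rule compact_imp_closed)
  show "?X \<subseteq> ?U"
  proof
    fix x assume x: "x \<in> ?X"
    show "x \<in> ?U"
    proof (cases "x \<in> ?F")
      case True
      then obtain i j where "cell h i j \<inter> A \<noteq> {}" "x \<in> cell h i j"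
        unfolding grid_nbhd_def by blast
      moreover from this have "cell h i j \<subseteq> ?F"
        unfolding grid_nbhd_def by blast
      then have "cell h i j \<subseteq> ?X"
        using outside_no_overlap[of ?F] by blast
      ultimately show ?thesis
        by blast
    next
      case False
      then have xin: "x \<in> inside ?F"
        using x by (simp add: inside_outside)
      obtain i j where ij: "x \<in> cell h i j"
        using in_floor_cell[OF h] by blast
      let ?Q = "cell h i j"
      have "cell h i j \<inter> A = {}"
        using False ij unfolding grid_nbhd_def by blast
      \<comment> \<open>The interior of a cell meets no other cell, and this one is not among those
        forming the neighbourhood.\<close>
      then have QF: "interior ?Q \<inter> ?F = {}"
        using interior_cell_Int_cell[OF h] unfolding grid_nbhd_def by fastforce
      have "interior ?Q \<noteq> {}"
      proof -
        have "Complex (h * (i + 1 / 2)) (h * (j + 1 / 2)) \<in> interior ?Q"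
          using h by (simp add: in_interior_cell)
        then show ?thesis by blast
      qed
      then have cl: "?Q \<subseteq> closure (interior ?Q)"
        using convex_closure_interior[OF convex_cell] closure_subset by metis
      have meets: "U \<inter> interior ?Q \<noteq> {}" if "open U" "U \<inter> ?Q \<noteq> {}" for U
        using that cl open_Int_closure_eq_empty[of U "interior ?Q"] by blast
      have "?Q \<subseteq> ?X"
      proof (rule ccontr)
        assume "\<not> ?Q \<subseteq> ?X"
        then have "outside ?F \<inter> interior ?Q \<noteq> {}"
          using meets open_outside[OF F] by blast
        moreover have "inside ?F \<inter> interior ?Q \<noteq> {}"
          using meets open_inside[OF F] xin ij by blast
        moreover have "connected (interior ?Q)"
          by (simp add: convex_cell convex_connected convex_interior)
        ultimately show False
          using inside_outside_intersect_connected[of "interior ?Q" ?F] QF by blast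
      qed
      then show ?thesis
        using ij by blast
    qed
  qed
qed

text \<open>Join \<open>z\<close> to a far point \<open>b\<close> by a path in the open connected
  set \<open>outside G\<close>. A fine enough grid neighbourhood misses the path and is bounded away
  from \<open>b\<close>, so \<open>z\<close> lies outside it together with \<open>b\<close>.\<close>

lemma ex_not_in_filled_grid_nbhd:
  assumes G: "compact G" and z: "z \<in> outside G"
  shows "\<exists>n. z \<in> outside (grid_nbhd ((1 / 2) ^ n) G)"
proof (cases "G = {}")
  case True
  then show ?thesis
    using z by (simp add: grid_nbhd_def)
next
  case False
  have opn: "open (outside G)" and con: "connected (outside G)"
    using G by (auto intro: open_outside connected_outside compact_imp_closed compact_imp_bounded)
  obtain R where R: "\<And>w. w \<in> G \<Longrightarrow> norm w \<le> R"
    using compact_imp_bounded[OF G] unfolding bounded_iff by blast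
  have "\<not> bounded (outside G)"
    using unbounded_outside compact_imp_bounded[OF G] by blast
  \<comment> \<open>The margin 2 covers all cells of side at most 1 that meet
    \<open>G\<close>.\<close>
  then obtain b where b: "b \<in> outside G" "R + 2 < norm b"
    unfolding bounded_iff by (meson not_le)
  obtain \<gamma> where g: "path \<gamma>" "path_image \<gamma> \<subseteq> outside G" "pathstart \<gamma> = z" "pathfinish \<gamma> = b"
    using connected_open_path_connected[OF opn con] z b(1) unfolding path_connected_def by blast
  have disj: "path_image \<gamma> \<inter> G = {}"
    using g(2) outside_no_overlap[of G] by blast
  have ne: "path_image \<gamma> \<noteq> {}"
    by simp
  then have "0 < setdist (path_image \<gamma>) G"
    using setdist_gt_0_compact_closed[OF compact_path_image[OF g(1)] compact_imp_closed[OF G]] False disj by blast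
  \<comment> \<open>Points of the neighbourhood are within \<open>2 * h\<close> of \<open>G\<close>,
    so \<open>h\<close> has to be below half the distance.\<close>
  then obtain n where n: "(1 / 2) ^ n < setdist (path_image \<gamma>) G / 2"
    using real_arch_pow_inv[of "setdist (path_image \<gamma>) G / 2" "1 / 2"] by auto
  define h :: real where "h = (1 / 2) ^ n"
  have h: "0 < h" "h \<le> 1" "2 * h < setdist (path_image \<gamma>) G"
    using n unfolding h_def by (auto simp: power_le_one)
  have avoid: "path_image \<gamma> \<inter> grid_nbhd h G = {}"
  proof (rule ccontr)
    assume "path_image \<gamma> \<inter> grid_nbhd h G \<noteq> {}"
    then obtain w a where "w \<in> path_image \<gamma>" "a \<in> G" "dist w a \<le> 2 * h"
      using grid_nbhd_dist by blast
    then show False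
      using setdist_le_dist[of w "path_image \<gamma>" a G] h(3) by linarith
  qed
  have "grid_nbhd h G \<subseteq> cball 0 (R + 2)"
  proof
    fix w assume "w \<in> grid_nbhd h G"
    then obtain a where a: "a \<in> G" "dist w a \<le> 2 * h"
      using grid_nbhd_dist by blast
    then have "norm w \<le> norm a + 2 * h"
      using norm_triangle_sub[of w a] by (simp add: dist_norm)
    then show "w \<in> cball 0 (R + 2)"
      using R[OF a(1)] h(2) by simp
  qed
  then have "- cball 0 (R + 2) \<subseteq> outside (grid_nbhd h G)"
    by (intro outside_subset_convex) auto
  then have "b \<in> outside (grid_nbhd h G)"
    using b(2) by auto
  moreover have "connected_component (- grid_nbhd h G) b z"
    unfolding connected_component_def using g avoid connected_path_image[OF g(1)]
      pathstart_in_path_image[of \<gamma>] pathfinish_in_path_image[of \<gamma>] by (intro exI[of _ "path_image \<gamma>"]) auto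
  ultimately show ?thesis
    using outside_same_component unfolding h_def by blast
qed

section \<open>The colourful theorem\<close>

definition filled_grid_nbhd :: "real \<Rightarrow> complex set \<Rightarrow> complex set" where
  "filled_grid_nbhd h A = - outside (grid_nbhd h A)"

lemma filled_grid_nbhd_eq: "filled_grid_nbhd h A = grid_nbhd h A \<union> inside (grid_nbhd h A)"
  unfolding filled_grid_nbhd_def by (rule union_with_inside[symmetric])

lemma subset_filled_grid_nbhd: "0 < h \<Longrightarrow> A \<subseteq> filled_grid_nbhd h A"
  using subset_grid_nbhd unfolding filled_grid_nbhd_eq by blast

lemma compact_filled_grid_nbhd:
  assumes "0 < h" "bounded A"
  shows "compact (filled_grid_nbhd h A)"
proof -
  have F: "compact (grid_nbhd h A)"
    using compact_grid_nbhd[OF assms] .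
  then have "bounded (filled_grid_nbhd h A)"
    unfolding filled_grid_nbhd_eq by (simp add: compact_imp_bounded bounded_inside)
  moreover have "closed (filled_grid_nbhd h A)"
    unfolding filled_grid_nbhd_def using F by (simp add: closed_Compl compact_imp_closed open_outside)
  ultimately show ?thesis
    by (simp add: compact_eq_bounded_closed)
qed

lemma connected_filled_grid_nbhd:
  assumes "0 < h" "bounded A" "connected A" "A \<noteq> {}"
  shows "connected (filled_grid_nbhd h A)"
  unfolding filled_grid_nbhd_eq
  by (intro connected_with_inside compact_imp_closed compact_grid_nbhd connected_grid_nbhd assms)

lemma connected_Compl_filled_grid_nbhd:
  assumes "0 < h" "bounded A"
  shows "connected (- filled_grid_nbhd h A)"
  unfolding filled_grid_nbhd_def double_complement
  by (intro connected_outside compact_imp_bounded compact_grid_nbhd assms) simp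

lemma filled_grid_nbhd_antimono:
  assumes "m \<le> n"
  shows "filled_grid_nbhd ((1 / 2) ^ n) A \<subseteq> filled_grid_nbhd ((1 / 2) ^ m) A"
  using assms
proof (induction n rule: dec_induct)
  case (step n)
  have "grid_nbhd ((1 / 2) ^ Suc n) A \<subseteq> grid_nbhd ((1 / 2) ^ n) A"
    using grid_nbhd_half_subset[of "(1 / 2) ^ n" A] by simp
  then show ?case
    using outside_mono step unfolding filled_grid_nbhd_def by blast
qed simp

lemma colorful_Helly_filled_grid_nbhd:
  fixes P :: "nat \<Rightarrow> complex set"
  assumes h: "0 < h" and A: "bounded A" "connected A" "A \<noteq> {}" and X: "X = filled_grid_nbhd h A"
    and P: "\<And>i. i \<in> {1, 2, 3} \<Longrightarrow> finite (P i) \<and> P i \<noteq> {}"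
    and ne: "\<And>p1 p2 p3. p1 \<in> P 1 \<Longrightarrow> p2 \<in> P 2 \<Longrightarrow> p3 \<in> P 3 \<Longrightarrow>
           \<exists>x. sees X x p1 \<and> sees X x p2 \<and> sees X x p3"
  shows "\<exists>i\<in>{1, 2, 3}. \<exists>x. \<forall>p\<in>P i. sees X x p"
proof -
  define S where "S = {(i, j). cell h i j \<subseteq> X}"
  have "S \<subseteq> {(i, j). cell h i j \<inter> X \<noteq> {}}"
    using corner_in_cell[OF h] unfolding S_def by blast
  then have "finite S"
    using finite_cells_meeting[OF h, of X] compact_filled_grid_nbhd[OF h A(1)] finite_subset
    unfolding X by (blast intro: compact_imp_bounded)
  moreover have "X = (\<Union>(i, j)\<in>S. cell h i j)"
    using Compl_outside_grid_nbhd_eq_cells[OF h A(1)] unfolding X S_def filled_grid_nbhd_def .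
  ultimately show ?thesis
    using connected_filled_grid_nbhd[OF h A] connected_Compl_filled_grid_nbhd[OF h A(1)] P ne
    unfolding X[symmetric] by (intro colorful_Helly_grid[OF _ h]) auto
qed

text \<open>At every scale some colour has a common viewpoint in \<open>X n\<close>. The sets
  \<open>W i n\<close> of such viewpoints decrease with \<open>n\<close>, so one colour works at all
  scales, and compactness yields a viewpoint common to all of them.\<close>

lemma colorful_Krasnoselskii_skeleton:
  fixes P :: "nat \<Rightarrow> complex set"
  assumes G: "compact G" "connected G" "G \<noteq> {}"
    and P: "\<And>i. i \<in> {1, 2, 3} \<Longrightarrow> finite (P i) \<and> P i \<noteq> {}"
    and ne: "\<And>p1 p2 p3. p1 \<in> P 1 \<Longrightarrow> p2 \<in> P 2 \<Longrightarrow> p3 \<in> P 3 \<Longrightarrow>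
           \<exists>x. sees G x p1 \<and> sees G x p2 \<and> sees G x p3"
  shows "\<exists>i\<in>{1, 2, 3}. \<exists>x. \<forall>p\<in>P i. sees (- outside G) x p"
proof -
  define X where "X n = filled_grid_nbhd ((1 / 2) ^ n) G" for n
  have bG: "bounded G"
    using G(1) by (rule compact_imp_bounded)
  have compX: "compact (X n)" for n
    unfolding X_def by (intro compact_filled_grid_nbhd bG) simp
  have GX: "G \<subseteq> X n" for n
    unfolding X_def by (intro subset_filled_grid_nbhd) simp
  have mono: "X n \<subseteq> X m" if "m \<le> n" for m n
    unfolding X_def using filled_grid_nbhd_antimono[OF that] .
  have limit: "(\<Inter>n. X n) \<subseteq> - outside G"
    using ex_not_in_filled_grid_nbhd[OF G(1)] unfolding X_def filled_grid_nbhd_def by auto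
  have sees_mono: "sees A x p \<Longrightarrow> A \<subseteq> B \<Longrightarrow> sees B x p" for A B x and p :: complex
    unfolding sees_def by blast
  define W where "W i n = {x. \<forall>p\<in>P i. sees (X n) x p}" for i n
  have W_mono: "W i n \<subseteq> W i m" if "m \<le> n" for i m n
    using sees_mono mono[OF that] unfolding W_def by blast
  have some: "\<exists>i\<in>{1, 2, 3}. W i n \<noteq> {}" for n
  proof -
    have "\<exists>i\<in>{1, 2, 3}. \<exists>x. \<forall>p\<in>P i. sees (X n) x p"
    proof (rule colorful_Helly_filled_grid_nbhd[OF _ bG G(2,3) X_def P])
      show "\<exists>x. sees (X n) x p1 \<and> sees (X n) x p2 \<and> sees (X n) x p3"
        if "p1 \<in> P 1" "p2 \<in> P 2" "p3 \<in> P 3" for p1 p2 p3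
        using ne[OF that] sees_mono GX by blast
    qed simp_all
    then show ?thesis
      unfolding W_def by blast
  qed
  obtain i where i: "i \<in> {1, 2, 3}" "\<And>n. W i n \<noteq> {}"
  proof (rule ccontr)
    assume no: "\<not> thesis"
    have "\<forall>i\<in>{1, 2, 3}. \<exists>n. W i n = {}"
      using no that by blast
    then obtain n where n: "\<And>i. i \<in> {1, 2, 3} \<Longrightarrow> W i (n i) = {}"
      by metis
    \<comment> \<open>At the largest of the three failing levels all three sets would be
      empty.\<close>
    define N where "N = Max (n ` {1, 2, 3})"
    have "W i N = {}" if "i \<in> {1, 2, 3}" for i
      using n[OF that] W_mono[of "n i" N i] that unfolding N_def by (metis Max_ge finite.intros finite_imageI imageI subset_empty)
    then show False
      using some[of N] by blast
  qed
  have "compact (W i n)" for n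
  proof -
    have "W i n = (\<Inter>p\<in>P i. {x. sees (X n) x p})"
      unfolding W_def by blast
    then show ?thesis
      using P[OF i(1)] compact_sees[OF compX] by (auto intro!: compact_Inter)
  qed
  then have "\<Inter>(range (W i)) \<noteq> {}"
    using i(2) W_mono by (intro compact_nest) blast+
  then obtain x where x: "\<And>n. x \<in> W i n"
    by blast
  have "sees (- outside G) x p" if "p \<in> P i" for p
  proof -
    have "sees (X n) x p" for n
      using x that unfolding W_def by blast
    then have "sees (\<Inter>n. X n) x p"
      unfolding sees_def by blast
    then show ?thesis
      using sees_mono limit by blast
  qed
  then show ?thesis
    using i(1) by blast
qed

text \<open>The stars joining each triple to a chosen witness form \<open>G\<close>, which retains
  the hypothesis on triples. Since \<open>- outside G\<close> lies in \<open>K\<close>, a common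
  viewpoint found there is one in \<open>K\<close>.\<close>

lemma colorful_Krasnoselskii_complex:
  fixes K :: "complex set" and P :: "nat \<Rightarrow> complex set"
  assumes K: "simply_connected K" "K \<noteq> {}"
    and P: "\<And>i. i \<in> {1, 2, 3} \<Longrightarrow> finite (P i) \<and> P i \<subseteq> K"
    and ne: "\<And>p1 p2 p3. p1 \<in> P 1 \<Longrightarrow> p2 \<in> P 2 \<Longrightarrow> p3 \<in> P 3 \<Longrightarrow>
           \<exists>x\<in>K. sees K x p1 \<and> sees K x p2 \<and> sees K x p3"
  shows "\<exists>i\<in>{1, 2, 3}. \<exists>x\<in>K. \<forall>p\<in>P i. sees K x p"
proof (cases "\<exists>i\<in>{1, 2, 3}. P i = {}")
  case True
  then show ?thesis
    using K(2) by blast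
next
  case False
  then have P': "finite (P i) \<and> P i \<noteq> {}" if "i \<in> {1, 2, 3}" for i
    using P that by blast
  have "\<forall>t\<in>P 1 \<times> P 2 \<times> P 3. \<exists>x. sees K x (fst t) \<and> sees K x (fst (snd t)) \<and> sees K x (snd (snd t))"
    using ne by force
  then obtain w where w: "\<And>a b c. a \<in> P 1 \<Longrightarrow> b \<in> P 2 \<Longrightarrow> c \<in> P 3 \<Longrightarrow>
      sees K (w (a, b, c)) a \<and> sees K (w (a, b, c)) b \<and> sees K (w (a, b, c)) c"
    by (subst (asm) bchoice_iff) force
  define seg where "seg t = {closed_segment (w t) (fst t), closed_segment (w t) (fst (snd t)), closed_segment (w t) (snd (snd t))}" for t
  define star where "star t = \<Union>(seg t)" for t
  define T where "T = P 1 \<times> P 2 \<times> P 3"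
  define G where "G = (\<Union>t\<in>T. star t)"
  have Gseg: "G = \<Union>(\<Union>t\<in>T. seg t)"
    unfolding G_def star_def by blast
  have finT: "finite T"
    unfolding T_def using P by blast
  have fin: "finite (\<Union>t\<in>T. seg t)"
    using finT by (auto simp: seg_def)
  have conv: "compact C \<and> convex C" if "C \<in> (\<Union>t\<in>T. seg t)" for C
    using that unfolding seg_def by auto
  have star: "connected (star t)" "w t \<in> star t" "fst t \<in> star t" "fst (snd t) \<in> star t" "snd (snd t) \<in> star t" for t
    unfolding star_def seg_def by (auto intro!: connected_Un)
  obtain a0 b0 c0 where t0: "a0 \<in> P 1" "b0 \<in> P 2" "c0 \<in> P 3"
    using P'[of 1] P'[of 2] P'[of 3] by auto
  have "connected (\<Union>(a, b, c)\<in>T. star (a0, b0, c0) \<union> star (a0, b, c) \<union> star (a, b, c))"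
  proof (rule connected_Union)
    fix S assume "S \<in> (\<lambda>(a, b, c). star (a0, b0, c0) \<union> star (a0, b, c) \<union> star (a, b, c)) ` T"
    then obtain a b c where S: "S = star (a0, b0, c0) \<union> star (a0, b, c) \<union> star (a, b, c)"
      by auto
    \<comment> \<open>Change the last two points first, keeping \<open>a0\<close>, and then the
      first, keeping \<open>b\<close>; consecutive stars share a point.\<close>
    have "a0 \<in> star (a0, b0, c0) \<inter> star (a0, b, c)" "b \<in> (star (a0, b0, c0) \<union> star (a0, b, c)) \<inter> star (a, b, c)"
      using star(3)[of "(a0, b0, c0)"] star(3,4)[of "(a0, b, c)"] star(4)[of "(a, b, c)"] by auto
    then show "connected S"
      unfolding S using star(1) by (intro connected_Un) blast+
  next
    have "w (a0, b0, c0) \<in> \<Inter>((\<lambda>(a, b, c). star (a0, b0, c0) \<union> star (a0, b, c) \<union> star (a, b, c)) ` T)"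
      using star(2) by auto
    then show "\<Inter>((\<lambda>(a, b, c). star (a0, b0, c0) \<union> star (a0, b, c) \<union> star (a, b, c)) ` T) \<noteq> {}"
      by blast
  qed
  also have "(\<Union>(a, b, c)\<in>T. star (a0, b0, c0) \<union> star (a0, b, c) \<union> star (a, b, c)) = G"
    unfolding G_def T_def using t0 by fast
  finally have "connected G" .
  have "compact G"
    unfolding Gseg using conv by (intro compact_Union fin) blast
  have "G \<noteq> {}"
    using t0 star(2) unfolding G_def T_def by blast
  \<comment> \<open>A finite union of closed convex sets is an ANR, which supplies local
    path-connectedness.\<close>
  have "ANR G"
    unfolding Gseg using fin conv by (intro ANR_finite_Union_convex_closed) (auto intro: compact_imp_closed)
  have "star (a, b, c) \<subseteq> K" if "a \<in> P 1" "b \<in> P 2" "c \<in> P 3" for a b c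
    using w[OF that] unfolding star_def seg_def sees_def by simp
  then have "G \<subseteq> K"
    unfolding G_def T_def by fast
  then have "- outside G \<subseteq> K"
    using outside_if_simply_connected[OF K(1) \<open>compact G\<close> \<open>connected G\<close> ANR_imp_locally_path_connected[OF \<open>ANR G\<close>]]
    by blast
  have "\<exists>i\<in>{1, 2, 3}. \<exists>x. \<forall>p\<in>P i. sees (- outside G) x p"
  proof (rule colorful_Krasnoselskii_skeleton[OF \<open>compact G\<close> \<open>connected G\<close> \<open>G \<noteq> {}\<close> P'])
    fix a b c assume abc: "a \<in> P 1" "b \<in> P 2" "c \<in> P 3"
    then have "star (a, b, c) \<subseteq> G"
      unfolding G_def T_def by blast
    then have "sees G (w (a, b, c)) p" if "p \<in> {a, b, c}" for p
      using that unfolding sees_def star_def seg_def by auto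
    then show "\<exists>x. sees G x a \<and> sees G x b \<and> sees G x c"
      by blast
  qed
  then obtain i x where i: "i \<in> {1, 2, 3}" "\<And>p. p \<in> P i \<Longrightarrow> sees (- outside G) x p"
    by blast
  have seesK: "sees K x p" if "p \<in> P i" for p
    using i(2)[OF that] \<open>- outside G \<subseteq> K\<close> unfolding sees_def by blast
  moreover have "x \<in> K"
    using P'[OF i(1)] seesK unfolding sees_def by blast
  ultimately show ?thesis
    using i(1) by blast
qed

lemma sees_linear_image:
  assumes "linear f" "inj f"
  shows "sees (f ` K) (f x) (f y) \<longleftrightarrow> sees K x y"
  unfolding sees_def closed_segment_linear_image[OF assms(1)]
  using assms(2) by (simp add: inj_image_mem_iff inj_image_subset_iff)

theorem theorem1p5:
  fixes K :: "(real ^ 2) set" and P :: "nat \<Rightarrow> (real ^ 2) set"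
  assumes "compact K" and "simply_connected K" and "K \<noteq> {}"
    and "\<And>i. i \<in> {1, 2, 3} \<Longrightarrow> finite (P i) \<and> P i \<subseteq> K"
    and "\<And>p1 p2 p3. p1 \<in> P 1 \<Longrightarrow> p2 \<in> P 2 \<Longrightarrow> p3 \<in> P 3 \<Longrightarrow>
           \<exists>x\<in>K. sees K x p1 \<and> sees K x p2 \<and> sees K x p3"
  shows "\<exists>i\<in>{1, 2, 3}. \<exists>x\<in>K. \<forall>p\<in>P i. sees K x p"
proof -
  \<comment> \<open>A linear isomorphism with the complex plane preserves segments, hence
    visibility.\<close>
  obtain f :: "real ^ 2 \<Rightarrow> complex" and g where f: "linear f" "\<And>x. g (f x) = x"
    by (rule isomorphisms_UNIV_UNIV[where 'M = "real ^ 2" and 'N = complex]) (simp, rule that)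
  have inj: "inj f"
    using f(2) by (metis injI)
  note sees_f = sees_linear_image[OF f(1) inj]
  have "\<exists>i\<in>{1, 2, 3}. \<exists>x\<in>f ` K. \<forall>p\<in>f ` P i. sees (f ` K) x p"
  proof (rule colorful_Krasnoselskii_complex)
    show "simply_connected (f ` K)"
      using homeomorphic_simply_connected[OF linear_homeomorphic_image[OF f(1) inj] assms(2)] .
    show "f ` K \<noteq> {}"
      using assms(3) by simp
    show "finite (f ` P i) \<and> f ` P i \<subseteq> f ` K" if "i \<in> {1, 2, 3}" for i
      using assms(4)[OF that] by blast
    fix p1 p2 p3 assume "p1 \<in> f ` P 1" "p2 \<in> f ` P 2" "p3 \<in> f ` P 3"
    then obtain q1 q2 q3 where "q1 \<in> P 1" "q2 \<in> P 2" "q3 \<in> P 3" "p1 = f q1" "p2 = f q2" "p3 = f q3"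
      by blast
    then show "\<exists>x\<in>f ` K. sees (f ` K) x p1 \<and> sees (f ` K) x p2 \<and> sees (f ` K) x p3"
      using assms(5) sees_f by (metis imageI)
  qed
  then show ?thesis
    by (simp add: sees_f)
qed

end
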